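(* Let $k,n$ be integers with $3 \leq k \leq n$ and let $H_n$ be the $n$-dimensional twisted hypercube. If $k$ is odd, then $\kappa(H_{n}; P_{k})=\kappa^{s}(H_{n}; P_{k})=\lceil\frac{2n}{k+1}\rceil$. If $k$ is even, then $\kappa(H_{n}; P_{k})=\kappa^{s}(H_{n}; P_{k})=\lceil\frac{2n}{k}\rceil$.
   Context: **Twisted hypercube.** Define an integer function $\kappa$ by $\kappa(1)=0$ and $\kappa(n)=\max\{1,\lceil \log_2 n-2\log_2\log_2 n\rceil\}$ for $n\ge 2$. Let $Z_2^n$ be the set of binary strings $x=x_1x_2\cdots x_n$ of length $n$. For $x\in Z_2^n$ ($n\ge1$), $\phi(x)\in Z_2^n$ is the string with $\phi(x)_j=x_j+x_{n-\kappa(n)+j} \pmod 2$ for $1\le j\le \kappa(n)$ and $\phi(x)_j=x_j$ for $\kappa(n)<j\le n$ ($\phi$ is an involution on $Z_2^n$). The graph $H_1$ is $K_2$ with vertices $0,1$. For $n\ge 2$, $H_n$ has vertex set $Z_2^n$ and is obtained from two copies $0H_{n-1}$ and $1H_{n-1}$ of $H_{n-1}$ (vertices prefixed by $0$ and $1$ respectively) by adding the edges joining $0x$ and $1\phi(x)$ for all $x\in Z_2^{n-1}$. **Structure connectivity.** Let $G$ be a graph and $T$ a connected graph that is isomorphic to a subgraph of $G$. For a set $\mathcal F$ of subgraphs of $G$ (not required to be disjoint), $G-\mathcal F$ is the subgraph of $G$ induced by the vertices belonging to no member of $\mathcal F$. $\mathcal F$ is a $T$-structure-cut if every member is isomorphic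 to $T$ and $G-\mathcal F$ is disconnected; it is a $T$-substructure-cut if every member is isomorphic to a connected subgraph of $T$ and $G-\mathcal F$ is disconnected. $\kappa(G;T)$ (resp. $\kappa^s(G;T)$) is the minimum cardinality of a $T$-structure-cut (resp. $T$-substructure-cut) of $G$. $P_k$ is the path on $k$ vertices. *)

theory Defs
  imports
    Complex_Main
    "HOL-Library.Extended_Nat"
    "HOL-Library.Z2"
    "Graph_Theory.Graph_Theory"
begin

text \<open>Undirected simple graphs are represented, as in the Graph Theory library, by loop-free
  symmetric digraphs: the edge \<open>uv\<close> is the pair of arcs \<open>(u, v)\<close>, \<open>(v, u)\<close>.\<close>

section \<open>Structure connectivity\<close>

text \<open>The library's \<^const>\<open>subgraph\<close> may keep only one of the two arcs of an edge; symmetry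
  excludes this, so that exactly the undirected subgraphs remain.\<close>

definition usubgraph :: "'a pair_pre_digraph \<Rightarrow> 'a pair_pre_digraph \<Rightarrow> bool" where
  "usubgraph F G \<longleftrightarrow> subgraph (with_proj F) (with_proj G) \<and> symmetric (with_proj F)"

definition isomorphic :: "'a pair_pre_digraph \<Rightarrow> 'b pair_pre_digraph \<Rightarrow> bool" where
  "isomorphic F T \<longleftrightarrow> digraph_iso (with_proj F) (with_proj T)"

text \<open>The library's \<open>connected\<close> fails for the graph without vertices. That graph is not regarded
  as disconnected either.\<close>

definition disconnected :: "('a, 'b) pre_digraph \<Rightarrow> bool" where
  "disconnected G \<longleftrightarrow> verts G \<noteq> {} \<and> \<not> Digraph_Component.connected G"

definition delete_subgraphs ::
    "'a pair_pre_digraph \<Rightarrow> 'a pair_pre_digraph set \<Rightarrow> ('a, 'a \<times> 'a) pre_digraph" where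
  "delete_subgraphs G \<F> = with_proj G \<restriction> (pverts G - (\<Union>F\<in>\<F>. pverts F))"

definition structure_cut ::
    "'a pair_pre_digraph \<Rightarrow> 'b pair_pre_digraph \<Rightarrow> 'a pair_pre_digraph set \<Rightarrow> bool" where
  "structure_cut G T \<F> \<longleftrightarrow>
     finite \<F> \<and> (\<forall>F\<in>\<F>. usubgraph F G \<and> isomorphic F T) \<and>
     disconnected (delete_subgraphs G \<F>)"

definition substructure_cut ::
    "'a pair_pre_digraph \<Rightarrow> 'b pair_pre_digraph \<Rightarrow> 'a pair_pre_digraph set \<Rightarrow> bool" where
  "substructure_cut G T \<F> \<longleftrightarrow>
     finite \<F> \<and>
     (\<forall>F\<in>\<F>. usubgraph F G \<and>
        (\<exists>S. usubgraph S T \<and> Digraph_Component.connected (with_proj S) \<and> isomorphic F S)) \<and>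
     disconnected (delete_subgraphs G \<F>)"

text \<open>The minimum is taken in \<^typ>\<open>enat\<close>: it is \<open>\<infinity>\<close> if there is no cut, and is attained otherwise.\<close>

definition structure_connectivity ::
    "'a pair_pre_digraph \<Rightarrow> 'b pair_pre_digraph \<Rightarrow> enat" where
  "structure_connectivity G T = (INF \<F>\<in>{\<F>. structure_cut G T \<F>}. enat (card \<F>))"

definition substructure_connectivity ::
    "'a pair_pre_digraph \<Rightarrow> 'b pair_pre_digraph \<Rightarrow> enat" where
  "substructure_connectivity G T = (INF \<F>\<in>{\<F>. substructure_cut G T \<F>}. enat (card \<F>))"

definition path_graph :: "nat \<Rightarrow> nat pair_pre_digraph" where
  "path_graph k = \<lparr> pverts = {..<k},
     parcs = {(i, j). i < k \<and> j < k \<and> (j = Suc i \<or> i = Suc j)} \<rparr>"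

section \<open>The twisted hypercube\<close>

definition kappa :: "nat \<Rightarrow> nat" where
  "kappa n = (if n \<le> 1 then 0
              else nat (max 1 \<lceil>log 2 (real n) - 2 * log 2 (log 2 (real n))\<rceil>))"

text \<open>List positions start at 0, so \<open>x ! i\<close> is the coordinate with index \<open>i + 1\<close>.\<close>

definition twist :: "bit list \<Rightarrow> bit list" where
  "twist x = (let n = length x in
     map (\<lambda>i. if i < kappa n then x ! i + x ! (n - kappa n + i) else x ! i) [0..<n])"

text \<open>The value at 0 is a placeholder.\<close>

fun twisted_hypercube :: "nat \<Rightarrow> bit list pair_pre_digraph" where
  "twisted_hypercube 0 = \<lparr> pverts = {[]}, parcs = {} \<rparr>"
| "twisted_hypercube (Suc 0) = \<lparr> pverts = {[0], [1]}, parcs = {([0], [1]), ([1], [0])} \<rparr>"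
| "twisted_hypercube (Suc (Suc m)) =
     \<lparr> pverts = {x. length x = Suc (Suc m)},
       parcs = {(b # x, b # y) | b x y. (x, y) \<in> parcs (twisted_hypercube (Suc m))}
             \<union> {(0 # x, 1 # twist x) | x. length x = Suc m}
             \<union> {(1 # twist x, 0 # x) | x. length x = Suc m} \<rparr>"

end

theory Submission
  imports Defs
begin

text \<open>Call a graph a bijective connection of dimension \<open>n\<close> if \<open>n = 0\<close> and it is a single vertex, or
  it consists of two bijective connections of dimension \<open>n - 1\<close> joined by a perfect matching;
  \<open>H\<^sub>n\<close> is one. The closed neighbourhoods of
  distinct vertices of such a graph share at most two vertices, so there is neither a triangle nor a
  \<open>K\<^sub>2\<^sub>,\<^sub>3\<close>. If the deletion of \<open>F\<close> leaves one half connected, then some union \<open>A\<close> of components lies in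
  the other half. Since the partners of \<open>A\<close> lie in \<open>F\<close>, the closed neighbourhood of \<open>A\<close> in that half
  has at most \<open>|F|\<close> vertices, and counting closed neighbourhoods makes \<open>A\<close> small: \<open>|A| \<le> 1\<close> if
  \<open>|F| \<le> 2n - 3\<close>, and \<open>|A| \<le> 2\<close> if \<open>|F| \<le> 2n - 2\<close> and \<open>n \<ge> 5\<close>.

  Put \<open>h = \<lceil>k/2\<rceil>\<close>; the asserted value is the least \<open>t\<close> with \<open>t h \<ge> n\<close>. Fewer paths delete at most
  \<open>2n - 2\<close> vertices. They cannot isolate a vertex, because the neighbours of a vertex are independent
  and a path meets an independent set in at most \<open>h\<close> vertices. They could isolate an edge \<open>ab\<close> only
  by covering its \<open>2n - 2\<close> neighbours exactly; but then three consecutive vertices of a path around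
  the edge would yield a \<open>K\<^sub>2\<^sub>,\<^sub>3\<close>.

  Conversely, \<open>e\<^sub>1, e\<^sub>1 + e\<^sub>2, e\<^sub>2, e\<^sub>2 + e\<^sub>3, \<dots>, e\<^sub>n\<close> is a path of \<open>H\<^sub>n\<close> through all neighbours of
  \<open>0\<close>, and \<open>t\<close> of its subpaths on \<open>k\<close> vertices suffice to cover these neighbours.\<close>

section \<open>Bijective connection graphs\<close>

text \<open>With closed neighbourhoods a single bound, at most two common elements, serves adjacent
  and non-adjacent vertices alike; for adjacent ones it excludes triangles.\<close>

definition closed_nbhd :: "'a rel \<Rightarrow> 'a set \<Rightarrow> 'a \<Rightarrow> 'a set" where
  "closed_nbhd R V x = insert x {y \<in> V. (x, y) \<in> R}"

text \<open>One direction of a perfect matching; for symmetric \<open>R\<close>, both directions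
  together say that the edges between \<open>A\<close> and \<open>B\<close> form one.\<close>

definition matched :: "'a rel \<Rightarrow> 'a set \<Rightarrow> 'a set \<Rightarrow> bool" where
  "matched R A B \<longleftrightarrow> (\<forall>x\<in>A. \<exists>!y. y \<in> B \<and> (x, y) \<in> R)"

text \<open>\<open>R\<close> stays fixed while \<open>V\<close> shrinks, so a half is an instance
  with the same relation; only arcs inside \<open>V\<close> matter.\<close>

primrec bijective_connection :: "'a rel \<Rightarrow> nat \<Rightarrow> 'a set \<Rightarrow> bool" where
  "bijective_connection R 0 V \<longleftrightarrow> (\<exists>v. V = {v} \<and> (v, v) \<notin> R)"
| "bijective_connection R (Suc n) V \<longleftrightarrow> (\<exists>V0 V1. V = V0 \<union> V1 \<and> V0 \<inter> V1 = {} \<and>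
     bijective_connection R n V0 \<and> bijective_connection R n V1 \<and> matched R V0 V1 \<and> matched R V1 V0)"

text \<open>Here \<open>n\<close> is the dimension of the halves, one less than that of
  \<open>V\<close>.\<close>

definition halves :: "'a rel \<Rightarrow> nat \<Rightarrow> 'a set \<Rightarrow> 'a set \<Rightarrow> 'a set \<Rightarrow> bool" where
  "halves R n V V0 V1 \<longleftrightarrow> V = V0 \<union> V1 \<and> V0 \<inter> V1 = {} \<and>
     bijective_connection R n V0 \<and> bijective_connection R n V1 \<and> matched R V0 V1 \<and> matched R V1 V0"

lemma halvesD:
  assumes "halves R n V V0 V1"
  shows "V = V0 \<union> V1" "V0 \<inter> V1 = {}" "bijective_connection R n V0" "bijective_connection R n V1"
    "matched R V0 V1" "matched R V1 V0"
  using assms unfolding halves_def by blast+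

lemma halves_sym: "halves R n V V0 V1 \<Longrightarrow> halves R n V V1 V0"
  unfolding halves_def by blast

lemma bc_SucE:
  assumes "bijective_connection R (Suc n) V"
  obtains V0 V1 where "halves R n V V0 V1"
  using assms unfolding halves_def by (auto simp del: Un_iff)

text \<open>\<open>A\<close> and \<open>B\<close> may be empty, so connectedness after deleting
  \<open>F\<close> means that one of them always is. When both are nonempty, \<open>F\<close>
  disconnects \<open>V\<close>.\<close>

definition separation :: "'a rel \<Rightarrow> 'a set \<Rightarrow> 'a set \<Rightarrow> 'a set \<Rightarrow> 'a set \<Rightarrow> bool" where
  "separation R V F A B \<longleftrightarrow> V = F \<union> A \<union> B \<and> F \<inter> A = {} \<and> F \<inter> B = {} \<and> A \<inter> B = {} \<and>
     (\<forall>a\<in>A. \<forall>b\<in>B. (a, b) \<notin> R)"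

lemma bc_finite: "bijective_connection R n V \<Longrightarrow> finite V"
  by (induction n arbitrary: V) auto

lemma bc_card: "bijective_connection R n V \<Longrightarrow> card V = 2 ^ n"
proof (induction n arbitrary: V)
  case (Suc n)
  then obtain V0 V1 where "V = V0 \<union> V1" "V0 \<inter> V1 = {}" "bijective_connection R n V0" "bijective_connection R n V1" by auto
  with Suc.IH show ?case by (simp add: card_Un_disjoint bc_finite)
qed auto

lemma bc_irrefl: "bijective_connection R n V \<Longrightarrow> x \<in> V \<Longrightarrow> (x, x) \<notin> R"
  by (induction n arbitrary: V) auto

text \<open>Used for prefixing a bit, which maps \<open>H_arcs n\<close> into
  \<open>H_arcs (Suc n)\<close>.\<close>

lemma bc_image:
  assumes "bijective_connection R n V" "inj_on f V" "\<And>x y. x \<in> V \<Longrightarrow> y \<in> V \<Longrightarrow> (f x, f y) \<in> S \<longleftrightarrow> (x, y) \<in> R"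
  shows "bijective_connection S n (f ` V)"
  using assms
proof (induction n arbitrary: V)
  case 0
  then show ?case by auto
next
  case (Suc n)
  then obtain V0 V1 where V: "V = V0 \<union> V1" "V0 \<inter> V1 = {}"
      "bijective_connection R n V0" "bijective_connection R n V1"
    "matched R V0 V1" "matched R V1 V0" by auto
  have i: "inj_on f V0" "inj_on f V1" "f ` V0 \<inter> f ` V1 = {}"
    using Suc.prems(2) V(1,2) by (auto simp: inj_on_Un inj_on_def)
  have "bijective_connection S n (f ` V0)" "bijective_connection S n (f ` V1)"
    using Suc.IH[OF V(3) i(1)] Suc.IH[OF V(4) i(2)] Suc.prems(3) V(1) by auto
  moreover have "matched S (f ` V0) (f ` V1)" "matched S (f ` V1) (f ` V0)"
    using V(5,6) Suc.prems(3) V(1) unfolding matched_def by (auto; metis UnI1 UnI2)+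
  ultimately show ?case using i(3) V(1) by (auto simp: image_Un)
qed

section \<open>Sizes and intersections of closed neighbourhoods\<close>

lemma closed_nbhd_subset: "x \<in> V \<Longrightarrow> closed_nbhd R V x \<subseteq> V"
  by (auto simp: closed_nbhd_def)

lemma closed_nbhd_Un_matched:
  assumes "matched R V0 V1" "x \<in> V0" "V0 \<inter> V1 = {}"
  obtains m where "m \<in> V1" "(x, m) \<in> R" "closed_nbhd R (V0 \<union> V1) x = insert m (closed_nbhd R V0 x)"
proof -
  have "\<exists>!y. y \<in> V1 \<and> (x, y) \<in> R" using assms(1,2) unfolding matched_def by blast
  then obtain m where m: "m \<in> V1" "(x, m) \<in> R" "\<forall>y. y \<in> V1 \<and> (x, y) \<in> R \<longrightarrow> y = m"
    by (elim ex1E) blast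
  have "closed_nbhd R (V0 \<union> V1) x = insert m (closed_nbhd R V0 x)"
    unfolding closed_nbhd_def using m by blast
  with m(1,2) show thesis by (rule that)
qed

lemma closed_nbhd_card_aux:
  assumes "matched R V0 V1" "V0 \<inter> V1 = {}" "x \<in> V0" "finite V0"
  shows "card (closed_nbhd R (V0 \<union> V1) x) = Suc (card (closed_nbhd R V0 x))"
proof -
  obtain m where m: "m \<in> V1" "closed_nbhd R (V0 \<union> V1) x = insert m (closed_nbhd R V0 x)"
    using closed_nbhd_Un_matched[OF assms(1,3,2)] by blast
  moreover have "m \<notin> closed_nbhd R V0 x" using m(1) assms(2,3) closed_nbhd_subset by fastforce
  ultimately show ?thesis
    using assms(3,4) finite_subset[OF closed_nbhd_subset] by (metis card_insert_disjoint)
qed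

lemma bc_card_closed_nbhd:
  "bijective_connection R n V \<Longrightarrow> x \<in> V \<Longrightarrow> card (closed_nbhd R V x) = Suc n"
proof (induction n arbitrary: V)
  case 0
  then show ?case by (auto simp: closed_nbhd_def)
next
  case (Suc n)
  then obtain V0 V1 where V: "V = V0 \<union> V1" "V0 \<inter> V1 = {}"
      "bijective_connection R n V0" "bijective_connection R n V1"
    "matched R V0 V1" "matched R V1 V0" by auto
  show ?case
  proof (cases "x \<in> V0")
    case True
    with closed_nbhd_card_aux[OF V(5,2)] Suc.IH[OF V(3)] V bc_finite show ?thesis by metis
  next
    case False
    then have "x \<in> V1" using Suc V by auto
    moreover have "V1 \<inter> V0 = {}" using V by auto
    ultimately show ?thesis
      using closed_nbhd_card_aux[OF V(6)] Suc.IH[OF V(4)] V bc_finite by (metis sup_commute)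
  qed
qed

text \<open>Each closed neighbourhood gains one vertex of \<open>V1\<close>, the partner; distinct
  vertices have distinct partners, so nothing new is shared.\<close>

lemma closed_nbhd_inter_same_half:
  assumes "sym R" "matched R V0 V1" "matched R V1 V0" "V0 \<inter> V1 = {}" "x \<in> V0" "y \<in> V0" "x \<noteq> y"
  shows "closed_nbhd R (V0 \<union> V1) x \<inter> closed_nbhd R (V0 \<union> V1) y
    = closed_nbhd R V0 x \<inter> closed_nbhd R V0 y"
proof -
  obtain m where m: "m \<in> V1" "(x, m) \<in> R" "closed_nbhd R (V0 \<union> V1) x = insert m (closed_nbhd R V0 x)"
    using closed_nbhd_Un_matched[OF assms(2,5,4)] .
  obtain k where k: "k \<in> V1" "(y, k) \<in> R" "closed_nbhd R (V0 \<union> V1) y = insert k (closed_nbhd R V0 y)"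
    using closed_nbhd_Un_matched[OF assms(2,6,4)] .
  have "(m, x) \<in> R" "(k, y) \<in> R" using m(2) k(2) assms(1) by (auto dest: symD)
  then have "m \<noteq> k" using m(1) assms(3,5-7) unfolding matched_def by blast
  moreover have nin: "m \<notin> closed_nbhd R V0 y" "k \<notin> closed_nbhd R V0 x"
    using m(1) k(1) closed_nbhd_subset[OF assms(5), of R] closed_nbhd_subset[OF assms(6), of R] assms(4)
    by blast+
  ultimately show ?thesis
    using m(3) k(3) nin by auto
qed

text \<open>Apart from the partner of \<open>x\<close>, everything near \<open>x\<close> lies in
  \<open>V0\<close>, and likewise for \<open>y\<close> and \<open>V1\<close>. Only the two partners
  can be shared.\<close>

lemma closed_nbhd_inter_cross:
  assumes "matched R V0 V1" "matched R V1 V0" "V0 \<inter> V1 = {}" "x \<in> V0" "y \<in> V1"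
  shows "card (closed_nbhd R (V0 \<union> V1) x \<inter> closed_nbhd R (V0 \<union> V1) y) \<le> 2"
proof -
  obtain m where m: "closed_nbhd R (V0 \<union> V1) x = insert m (closed_nbhd R V0 x)"
    using closed_nbhd_Un_matched[OF assms(1,4,3)] by blast
  have "V1 \<inter> V0 = {}" using assms(3) by auto
  then obtain k where k: "closed_nbhd R (V0 \<union> V1) y = insert k (closed_nbhd R V1 y)"
    using closed_nbhd_Un_matched[OF assms(2,5)] by (metis sup_commute)
  have "closed_nbhd R (V0 \<union> V1) x \<inter> closed_nbhd R (V0 \<union> V1) y \<subseteq> {m, k}"
    using m k closed_nbhd_subset[OF assms(4), of R] closed_nbhd_subset[OF assms(5), of R] assms(3) by auto
  then have "card (closed_nbhd R (V0 \<union> V1) x \<inter> closed_nbhd R (V0 \<union> V1) y) \<le> card {m, k}"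
    by (intro card_mono) auto
  also have "\<dots> \<le> 2" by (simp add: card_insert_if)
  finally show ?thesis .
qed

lemma bc_card_closed_nbhd_inter:
  assumes "sym R"
  shows "bijective_connection R n V \<Longrightarrow> x \<in> V \<Longrightarrow> y \<in> V \<Longrightarrow> x \<noteq> y \<Longrightarrow> card (closed_nbhd R V x \<inter> closed_nbhd R V y) \<le> 2"
proof (induction n arbitrary: V)
  case 0
  then show ?case by auto
next
  case (Suc n)
  then obtain V0 V1 where V: "V = V0 \<union> V1" "V0 \<inter> V1 = {}"
      "bijective_connection R n V0" "bijective_connection R n V1"
    "matched R V0 V1" "matched R V1 V0" by auto
  have V': "V = V1 \<union> V0" "V1 \<inter> V0 = {}" using V by auto
  consider "x \<in> V0" "y \<in> V0" | "x \<in> V1" "y \<in> V1" | "x \<in> V0" "y \<in> V1" | "x \<in> V1" "y \<in> V0"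
    using Suc.prems V(1) by auto
  then show ?case
  proof cases
    case 1
    then show ?thesis
      using closed_nbhd_inter_same_half[OF assms V(5,6,2)] Suc.IH[OF V(3)] Suc.prems(4) V(1) by metis
  next
    case 2
    then show ?thesis
      using closed_nbhd_inter_same_half[OF assms V(6,5) V'(2)] Suc.IH[OF V(4)] Suc.prems(4) V'(1) by metis
  next
    case 3
    then show ?thesis using closed_nbhd_inter_cross[OF V(5,6,2)] V(1) by metis
  next
    case 4
    then show ?thesis using closed_nbhd_inter_cross[OF V(6,5) V'(2)] V'(1) by metis
  qed
qed

lemma bc_no_three_common:
  assumes "sym R" "bijective_connection R n V" "x \<in> V" "y \<in> V" "x \<noteq> y" "card S = 3"
    "S \<subseteq> closed_nbhd R V x" "S \<subseteq> closed_nbhd R V y"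
  shows False
proof -
  have "card S \<le> card (closed_nbhd R V x \<inter> closed_nbhd R V y)"
    using assms bc_finite[OF assms(2)] by (intro card_mono) (auto simp: closed_nbhd_def)
  with bc_card_closed_nbhd_inter[OF assms(1-5)] assms(6) show False by simp
qed

lemma bc_triangle_free:
  assumes "sym R" "bijective_connection R n V" "x \<in> V" "y \<in> V" "z \<in> V" "(x, y) \<in> R" "(y, z) \<in> R" "(x, z) \<in> R"
  shows False
proof -
  have "x \<noteq> y" "y \<noteq> z" "x \<noteq> z" using assms bc_irrefl by metis+
  then have "card {x, y, z} = 3" by simp
  moreover have "(y, x) \<in> R" using assms(1,6) by (auto dest: symD)
  then have "{x, y, z} \<subseteq> closed_nbhd R V x" "{x, y, z} \<subseteq> closed_nbhd R V y"
    using assms(3-8) by (auto simp: closed_nbhd_def)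
  ultimately show False using bc_no_three_common[OF assms(1-4) \<open>x \<noteq> y\<close>] by blast
qed

section \<open>Separations by few vertices\<close>

lemma separation_sym: "sym R \<Longrightarrow> separation R V F A B \<Longrightarrow> separation R V F B A"
  unfolding separation_def by (auto dest: symD)

lemma separation_restrict:
  "separation R V F A B \<Longrightarrow> W \<subseteq> V \<Longrightarrow> separation R W (F \<inter> W) (A \<inter> W) (B \<inter> W)"
  unfolding separation_def by auto

lemma separation_nbhd:
  "separation R V F A B \<Longrightarrow> a \<in> A \<Longrightarrow> closed_nbhd R V a \<subseteq> A \<union> F"
  unfolding separation_def closed_nbhd_def by auto

text \<open>The partner map from \<open>X\<close> to \<open>V0\<close> is injective, because
  partners are also unique seen from \<open>V0\<close>.\<close>

lemma card_matched_le:
  assumes "sym R" "matched R X V0" "matched R V0 V1" "X \<subseteq> V1" "\<And>x y. x \<in> X \<Longrightarrow> y \<in> V0 \<Longrightarrow> (x, y) \<in> R \<Longrightarrow> y \<in> Y"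
    "finite Y"
  shows "card X \<le> card Y"
proof -
  have "\<forall>x\<in>X. \<exists>y. y \<in> V0 \<and> (x, y) \<in> R" using assms(2) unfolding matched_def by blast
  then obtain f where f: "\<And>x. x \<in> X \<Longrightarrow> f x \<in> V0 \<and> (x, f x) \<in> R" by metis
  show ?thesis
  proof (rule card_inj_on_le[of f])
    show "inj_on f X"
    proof (rule inj_onI)
      fix x y
      assume *: "x \<in> X" "y \<in> X" "f x = f y"
      then have "(f x, x) \<in> R" "(f x, y) \<in> R" using f[of x] f[of y] assms(1) by (auto dest: symD)
      moreover have "x \<in> V1" "y \<in> V1" using * assms(4) by auto
      ultimately show "x = y" using f[OF *(1)] assms(3) unfolding matched_def by blast
    qed
    show "f ` X \<subseteq> Y" using f assms(5) by blast
  qed (fact assms)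
qed

lemma halves_card:
  assumes "halves R n V V0 V1" "X \<subseteq> V"
  shows "card X = card (X \<inter> V0) + card (X \<inter> V1)"
proof -
  note V = halvesD[OF assms(1)]
  have "finite V" using V(1) bc_finite[OF V(3)] bc_finite[OF V(4)] by simp
  then have "finite X" using assms(2) by (rule finite_subset[rotated])
  moreover have "X \<inter> V0 \<union> X \<inter> V1 = X" using V(1) assms(2) by blast
  moreover have "(X \<inter> V0) \<inter> (X \<inter> V1) = {}" using V(2) by blast
  ultimately show ?thesis using card_Un_disjoint[of "X \<inter> V0" "X \<inter> V1"] by simp
qed

text \<open>The partner in \<open>V0\<close> of a vertex of \<open>A\<close> is neither in
  \<open>A\<close> nor in \<open>B\<close>, hence in \<open>F\<close>; so \<open>A\<close> is no
  larger than \<open>F \<inter> V0\<close>. Inside \<open>V1\<close>, the closed neighbourhoods stay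
  in \<open>A\<close> and \<open>F \<inter> V1\<close>.\<close>

lemma separation_half_card:
  assumes "sym R" and h: "halves R n V V0 V1" and sep: "separation R V F A B" and "A \<inter> V0 = {}"
  shows "A \<subseteq> V1" "card (\<Union>a\<in>A. closed_nbhd R V1 a) \<le> card F"
proof -
  note V = halvesD[OF h]
  have V_eq: "V = F \<union> A \<union> B" using sep unfolding separation_def by blast
  show sub: "A \<subseteq> V1" using V_eq V(1) assms(4) by blast
  have fin: "finite V0" "finite V1" using V(3,4) bc_finite by auto
  have "card A \<le> card (F \<inter> V0)"
  proof (rule card_matched_le[OF assms(1) _ V(5) sub])
    show "matched R A V0" using V(6) sub unfolding matched_def by blast
    show "y \<in> F \<inter> V0" if "x \<in> A" "y \<in> V0" "(x, y) \<in> R" for x y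
      using that sep V(1) assms(4) unfolding separation_def by blast
  qed (use fin in auto)
  moreover have "(\<Union>a\<in>A. closed_nbhd R V1 a) \<subseteq> A \<union> (F \<inter> V1)"
    using sep sub V(1) unfolding separation_def closed_nbhd_def by blast
  then have "card (\<Union>a\<in>A. closed_nbhd R V1 a) \<le> card (A \<union> (F \<inter> V1))"
    using fin(2) sub finite_subset by (intro card_mono) auto
  moreover have "card (A \<union> (F \<inter> V1)) \<le> card A + card (F \<inter> V1)" by (rule card_Un_le)
  moreover have "card F = card (F \<inter> V0) + card (F \<inter> V1)" using halves_card[OF h] V_eq by blast
  ultimately show "card (\<Union>a\<in>A. closed_nbhd R V1 a) \<le> card F" by linarith
qed

text \<open>Inclusion-exclusion with sets of size \<open>n + 1\<close> meeting pairwise in at most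
  two elements: 2(n + 1) - 2 = 2n, and a third set adds at least n + 1 - 4. The last bound is
  written additively to avoid truncated subtraction.\<close>

lemma card_closed_nbhd_Union_ge:
  assumes "sym R" "bijective_connection R n V" "A \<subseteq> V"
  shows "A \<noteq> {} \<Longrightarrow> Suc n \<le> card (\<Union>a\<in>A. closed_nbhd R V a)"
    and "2 \<le> card A \<Longrightarrow> 2 * n \<le> card (\<Union>a\<in>A. closed_nbhd R V a)"
    and "3 \<le> card A \<Longrightarrow> 3 * n \<le> card (\<Union>a\<in>A. closed_nbhd R V a) + 3"
proof -
  let ?N = "closed_nbhd R V"
  have fN: "finite (?N x)" for x using bc_finite[OF assms(2)] by (simp add: closed_nbhd_def)
  have fU: "finite (\<Union>a\<in>A. ?N a)" using fN bc_finite[OF assms(2)] assms(3) finite_subset by blast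
  have two: "2 * n \<le> card (?N x \<union> ?N y)" if "x \<in> A" "y \<in> A" "x \<noteq> y" for x y
  proof -
    have "x \<in> V" "y \<in> V" using that assms(3) by auto
    then have "card (?N x) = Suc n" "card (?N y) = Suc n" "card (?N x \<inter> ?N y) \<le> 2"
      using bc_card_closed_nbhd[OF assms(2)] bc_card_closed_nbhd_inter[OF assms(1,2)] that(3) by auto
    then show ?thesis using card_Un_Int[OF fN fN, of x y] by linarith
  qed
  show "Suc n \<le> card (\<Union>a\<in>A. ?N a)" if ne: "A \<noteq> {}"
  proof -
    obtain x where "x \<in> A" using ne by blast
    then have "card (?N x) \<le> card (\<Union>a\<in>A. ?N a)" by (intro card_mono fU) auto
    then show ?thesis using bc_card_closed_nbhd[OF assms(2)] \<open>x \<in> A\<close> assms(3) by auto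
  qed
  show "2 * n \<le> card (\<Union>a\<in>A. ?N a)" if le: "2 \<le> card A"
  proof -
    obtain S where "S \<subseteq> A" "card S = 2" using obtain_subset_with_card_n[OF le] by metis
    then obtain x y where "x \<in> A" "y \<in> A" "x \<noteq> y" by (auto simp: card_2_iff)
    moreover then have "card (?N x \<union> ?N y) \<le> card (\<Union>a\<in>A. ?N a)" by (intro card_mono fU) auto
    ultimately show ?thesis using two by fastforce
  qed
  show "3 * n \<le> card (\<Union>a\<in>A. ?N a) + 3" if le: "3 \<le> card A"
  proof -
    obtain S where "S \<subseteq> A" "card S = 3" using obtain_subset_with_card_n[OF le] by metis
    then obtain x y z where xyz: "x \<in> A" "y \<in> A" "z \<in> A" "x \<noteq> y" "y \<noteq> z" "x \<noteq> z"
      by (auto simp: card_3_iff)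
    have "card (?N x \<union> ?N y \<union> ?N z) \<le> card (\<Union>a\<in>A. ?N a)" using xyz by (intro card_mono fU) auto
    moreover have "card (?N z) + card (?N x \<union> ?N y)
        = card (?N x \<union> ?N y \<union> ?N z) + card ((?N x \<union> ?N y) \<inter> ?N z)"
      using card_Un_Int[of "?N x \<union> ?N y" "?N z"] fN by simp
    moreover have "card ((?N x \<union> ?N y) \<inter> ?N z) \<le> card (?N x \<inter> ?N z) + card (?N y \<inter> ?N z)"
      unfolding Int_Un_distrib2 by (rule card_Un_le)
    moreover have "card (?N x \<inter> ?N z) \<le> 2" "card (?N y \<inter> ?N z) \<le> 2"
      using bc_card_closed_nbhd_inter[OF assms(1,2)] xyz assms(3) by auto
    moreover have "card (?N z) = Suc n" using bc_card_closed_nbhd[OF assms(2)] xyz assms(3) by auto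
    ultimately show ?thesis using two[OF xyz(1,2,4)] by linarith
  qed
qed

text \<open>If deleting \<open>F\<close> leaves one half connected, then one side of the separation lies in the other half.\<close>

lemma separation_connected_half:
  assumes "sym R" and h: "halves R n V V0 V1" and sep: "separation R V F A B"
    and conn: "\<And>W C D. bijective_connection R n W \<Longrightarrow> separation R W (F \<inter> W) C D \<Longrightarrow> card (F \<inter> W) < n \<Longrightarrow> C = {} \<or> D = {}"
    and small: "card (F \<inter> V0) < n \<or> card (F \<inter> V1) < n"
  obtains X W where "X = A \<or> X = B" "bijective_connection R n W" "X \<subseteq> W" "card (\<Union>a\<in>X. closed_nbhd R W a) \<le> card F"
proof -
  \<comment> \<open>\<open>W\<close> is the half that stays connected; the side missing it lies in
    \<open>W'\<close>.\<close>
  obtain W W' where W: "halves R n V W W'" "card (F \<inter> W) < n"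
    using h halves_sym[OF h] small by blast
  have "W \<subseteq> V" using halvesD(1)[OF W(1)] by blast
  then consider "A \<inter> W = {}" | "B \<inter> W = {}"
    using conn[OF halvesD(3)[OF W(1)] separation_restrict[OF sep] W(2)] by blast
  then show thesis
  proof cases
    case 1
    show thesis
      using separation_half_card[OF assms(1) W(1) sep 1] halvesD(4)[OF W(1)] by (intro that[of A W']) auto
  next
    case 2
    show thesis
      using separation_half_card[OF assms(1) W(1) separation_sym[OF assms(1) sep] 2] halvesD(4)[OF W(1)]
      by (intro that[of B W']) auto
  qed
qed

text \<open>One half loses fewer than \<open>n\<close> vertices and is connected by induction. A
  nonempty side in the other half would have at least \<open>Suc n\<close> vertices in its closed
  neighbourhood, more than \<open>card F\<close>.\<close>

lemma bc_connectivity: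
  assumes "sym R"
  shows "bijective_connection R n V \<Longrightarrow> separation R V F A B \<Longrightarrow> card F < n \<Longrightarrow> A = {} \<or> B = {}"
proof (induction n arbitrary: V F A B)
  case 0
  then show ?case by simp
next
  case (Suc n)
  obtain V0 V1 where h: "halves R n V V0 V1" using Suc.prems(1) by (rule bc_SucE)
  have F: "F \<subseteq> V" using Suc.prems(2) unfolding separation_def by blast
  show ?case
  \<comment> \<open>For halves of dimension 0 no set has fewer than 0 elements, so the single edge
    is treated directly.\<close>
  proof (cases n)
    case 0
    then obtain a b where ab: "V0 = {a}" "V1 = {b}" using halvesD(3,4)[OF h] by auto
    then have R: "(a, b) \<in> R" "(b, a) \<in> R" using halvesD(5,6)[OF h] unfolding matched_def by blast+
    have V: "V = {a, b}" using ab halvesD(1)[OF h] by blast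
    have "F = {}" using Suc.prems(3) 0 finite_subset[OF F bc_finite[OF Suc.prems(1)]] by simp
    then show ?thesis using Suc.prems(2) R V unfolding separation_def by blast
  next
    case (Suc k)
    then have "card (F \<inter> V0) < n \<or> card (F \<inter> V1) < n"
      using Suc.prems(3) halves_card[OF h F] by linarith
    from separation_connected_half[OF assms h Suc.prems(2) Suc.IH this]
    obtain X W where X: "X = A \<or> X = B" "bijective_connection R n W" "X \<subseteq> W"
      "card (\<Union>a\<in>X. closed_nbhd R W a) \<le> card F" .
    have "X = {}"
    proof (rule ccontr)
      assume "X \<noteq> {}"
      from card_closed_nbhd_Union_ge(1)[OF assms X(2,3) this] X(4) Suc.prems(3) show False by linarith
    qed
    with X(1) show ?thesis by blast
  qed
qed

text \<open>In terms of the dimension \<open>m = n - 1\<close> of the halves, at most 2m - 1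
  vertices are deleted: one half loses fewer than \<open>m\<close>, and two vertices on the side in
  the other half would require 2m.\<close>

lemma bc_separation_singleton:
  assumes "sym R" "bijective_connection R n V" "separation R V F A B" "card F + 3 \<le> 2 * n"
  shows "card A \<le> 1 \<or> card B \<le> 1"
proof -
  obtain m where m: "n = Suc m" using assms(4) by (cases n) auto
  obtain V0 V1 where h: "halves R m V V0 V1" using assms(2) m bc_SucE by metis
  have "F \<subseteq> V" using assms(3) unfolding separation_def by blast
  then have "card (F \<inter> V0) < m \<or> card (F \<inter> V1) < m" using assms(4) m halves_card[OF h] by force
  from separation_connected_half[OF assms(1) h assms(3) bc_connectivity[OF assms(1)] this]
  obtain X W where X: "X = A \<or> X = B" "bijective_connection R m W" "X \<subseteq> W" "card (\<Union>a\<in>X. closed_nbhd R W a) \<le> card F" .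
  then have "card X \<le> 1"
    using card_closed_nbhd_Union_ge(2)[OF assms(1) X(2,3)] assms(4) m by linarith
  with X(1) show ?thesis by blast
qed

text \<open>Apart from at most \<open>m + 1\<close> vertices, \<open>V1\<close> belongs to
  \<open>A\<close>; the partners of these vertices lie in \<open>F\<close> or \<open>A\<close>
  within \<open>V0\<close>, again at most \<open>m + 1\<close> vertices. But
  \<open>2 ^ m > 2 * m + 2\<close> from \<open>m = 4\<close> on.\<close>

lemma halves_separation_cross:
  assumes "sym R" and h: "halves R m V V0 V1" and sep: "separation R V F A B"
    and card: "card (F \<inter> V0) \<le> m" "card (F \<inter> V1) \<le> m" "4 \<le> m" "card (A \<inter> V0) \<le> 1" "card (B \<inter> V1) \<le> 1"
  shows False
proof -
  note V = halvesD[OF h]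
  have fin: "finite V0" "finite V1" using V(3,4) bc_finite by auto
  have "V = F \<union> A \<union> B" using sep unfolding separation_def by blast
  then have "V1 = (F \<inter> V1) \<union> (B \<inter> V1) \<union> (A \<inter> V1)" using V(1) by blast
  then have "card V1 \<le> card ((F \<inter> V1) \<union> (B \<inter> V1)) + card (A \<inter> V1)"
    using card_Un_le by metis
  moreover have "card ((F \<inter> V1) \<union> (B \<inter> V1)) \<le> card (F \<inter> V1) + card (B \<inter> V1)" by (rule card_Un_le)
  moreover have "card (A \<inter> V1) \<le> card ((F \<inter> V0) \<union> (A \<inter> V0))"
  proof (rule card_matched_le[OF assms(1) _ V(5)])
    show "matched R (A \<inter> V1) V0" using V(6) unfolding matched_def by blast
    show "y \<in> F \<inter> V0 \<union> A \<inter> V0" if "x \<in> A \<inter> V1" "y \<in> V0" "(x, y) \<in> R" for x y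
      using that sep V(1) unfolding separation_def by blast
  qed (use fin in auto)
  moreover have "card ((F \<inter> V0) \<union> (A \<inter> V0)) \<le> card (F \<inter> V0) + card (A \<inter> V0)" by (rule card_Un_le)
  ultimately have le: "2 ^ m \<le> 2 * m + 2" using bc_card[OF V(4)] card by linarith
  have "2 * m + 2 < 2 ^ m" using card(3)
    by (induction m rule: dec_induct) auto
  with le show False by simp
qed

text \<open>If a half stays connected, three vertices on the side in the other half would require 3m
  - 3 > 2m. Otherwise each half loses exactly \<open>m\<close> vertices and has a side with at most
  one vertex; by \<open>halves_separation_cross\<close> the small sides belong to the same one of
  \<open>A\<close> and \<open>B\<close>.\<close>

lemma bc_separation_pair:
  assumes "sym R" "bijective_connection R (Suc m) V" "separation R V F A B" "card F \<le> 2 * m" "4 \<le> m"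
  shows "card A \<le> 2 \<or> card B \<le> 2"
proof -
  obtain V0 V1 where h: "halves R m V V0 V1" using assms(2) by (rule bc_SucE)
  note V = halvesD[OF h]
  have V_eq: "V = F \<union> A \<union> B" using assms(3) unfolding separation_def by blast
  show ?thesis
  proof (cases "card (F \<inter> V0) < m \<or> card (F \<inter> V1) < m")
    case True
    from separation_connected_half[OF assms(1) h assms(3) bc_connectivity[OF assms(1)] this]
    obtain X W where X: "X = A \<or> X = B" "bijective_connection R m W" "X \<subseteq> W"
      "card (\<Union>a\<in>X. closed_nbhd R W a) \<le> card F" .
    then have "card X \<le> 2"
      using card_closed_nbhd_Union_ge(3)[OF assms(1) X(2,3)] assms(4,5) by linarith
    with X(1) show ?thesis by blast
  next
    case False
    moreover have "card F = card (F \<inter> V0) + card (F \<inter> V1)" using halves_card[OF h] V_eq by blast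
    ultimately have m: "card (F \<inter> V0) \<le> m" "card (F \<inter> V1) \<le> m" using assms(4) by auto
    have sub: "V0 \<subseteq> V" "V1 \<subseteq> V" using V(1) by auto
    have h0: "card (A \<inter> V0) \<le> 1 \<or> card (B \<inter> V0) \<le> 1"
      using bc_separation_singleton[OF assms(1) V(3) separation_restrict[OF assms(3) sub(1)]] m assms(5) by simp
    have h1: "card (A \<inter> V1) \<le> 1 \<or> card (B \<inter> V1) \<le> 1"
      using bc_separation_singleton[OF assms(1) V(4) separation_restrict[OF assms(3) sub(2)]] m assms(5) by simp
    have "\<not> (card (A \<inter> V0) \<le> 1 \<and> card (B \<inter> V1) \<le> 1)"
      using halves_separation_cross[OF assms(1) h assms(3) m assms(5)] by blast
    moreover have "\<not> (card (B \<inter> V0) \<le> 1 \<and> card (A \<inter> V1) \<le> 1)"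
      using halves_separation_cross[OF assms(1) h separation_sym[OF assms(1,3)] m assms(5)] by blast
    moreover have "card A = card (A \<inter> V0) + card (A \<inter> V1)" "card B = card (B \<inter> V0) + card (B \<inter> V1)"
      using halves_card[OF h] V_eq by blast+
    ultimately show ?thesis using h0 h1 by linarith
  qed
qed

section \<open>Cuts of bijective connection graphs by paths\<close>

text \<open>An independent set meets each of the pairs of positions \<open>2 i\<close>, \<open>2 i + 1\<close> at most once.\<close>

lemma card_independent_le:
  fixes f :: "'a \<Rightarrow> nat"
  assumes "inj_on f P" "f ` P \<subseteq> {..<k}" "sym R"
    "\<And>u v. u \<in> P \<Longrightarrow> v \<in> P \<Longrightarrow> f v = Suc (f u) \<Longrightarrow> (u, v) \<in> R"
    "I \<subseteq> P" "\<And>u v. u \<in> I \<Longrightarrow> v \<in> I \<Longrightarrow> (u, v) \<notin> R"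
  shows "card I \<le> (k + 1) div 2"
proof -
  have "card I \<le> card {..<(k + 1) div 2}"
  proof (rule card_inj_on_le[of "\<lambda>u. f u div 2"])
    show "inj_on (\<lambda>u. f u div 2) I"
    proof (rule inj_onI)
      fix u v
      assume uv: "u \<in> I" "v \<in> I" "f u div 2 = f v div 2"
      then have "u \<in> P" "v \<in> P" "(u, v) \<notin> R" "(v, u) \<notin> R" using assms(5,6) by auto
      then have "f v \<noteq> Suc (f u)" "f u \<noteq> Suc (f v)" using assms(4)[of u v] assms(4)[of v u] by auto
      moreover have "a = b" if "a div 2 = b div 2" "b \<noteq> Suc a" "a \<noteq> Suc b" for a b :: nat
        using that by linarith
      ultimately have "f u = f v" using uv(3) by blast
      then show "u = v" using assms(1,5) uv(1,2) by (auto dest: inj_onD)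
    qed
    show "(\<lambda>u. f u div 2) ` I \<subseteq> {..<(k + 1) div 2}"
    proof
      fix j
      assume "j \<in> (\<lambda>u. f u div 2) ` I"
      then obtain u where "j = f u div 2" "f u < k" using assms(2,5) by blast
      then show "j \<in> {..<(k + 1) div 2}" by auto
    qed
  qed simp
  then show ?thesis by simp
qed

lemma card_Union_le_times:
  assumes "finite \<F>" "\<And>F. F \<in> \<F> \<Longrightarrow> card (g F) \<le> c"
  shows "card (\<Union>F\<in>\<F>. g F) \<le> card \<F> * c"
proof -
  have "card (\<Union>F\<in>\<F>. g F) \<le> (\<Sum>F\<in>\<F>. card (g F))" by (rule card_UN_le[OF assms(1)])
  also have "\<dots> \<le> of_nat (card \<F>) * c" by (rule sum_bounded_above) (rule assms(2))
  finally show ?thesis by simp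
qed

text \<open>As \<open>p1\<close> is adjacent to \<open>b\<close>, absence of triangles forces
  \<open>p0\<close> and \<open>p2\<close> to be adjacent to \<open>a\<close>. Then \<open>a\<close>
  and \<open>p1\<close> have the three common neighbours \<open>p0\<close>, \<open>p2\<close>,
  \<open>b\<close>.\<close>

lemma bc_no_path_around_edge:
  assumes "sym R" "bijective_connection R n V" "a \<in> V" "b \<in> V" "(a, b) \<in> R"
    "p0 \<in> V - {a, b}" "p1 \<in> V - {a, b}" "p2 \<in> V - {a, b}" "p0 \<noteq> p2" "(p0, p1) \<in> R" "(p1, p2) \<in> R"
    "(a, p0) \<in> R \<or> (b, p0) \<in> R" "(b, p1) \<in> R" "(a, p2) \<in> R \<or> (b, p2) \<in> R"
  shows False
proof -
  have sy: "(y, x) \<in> R" if "(x, y) \<in> R" for x y using assms(1) that by (rule symD)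
  have tri: "(b, p) \<notin> R" if "(p, p1) \<in> R" "p \<in> V" for p
    using bc_triangle_free[OF assms(1,2,4) that(2) _ _ that(1) assms(13)] assms(7) by auto
  have "(b, p0) \<notin> R" "(b, p2) \<notin> R" using tri assms(6,8,10,11) sy by auto
  then have ap: "(a, p0) \<in> R" "(a, p2) \<in> R" using assms(12,14) by auto
  have "{p0, p2, b} \<subseteq> closed_nbhd R V a" using ap assms(4,5,6,8) by (simp add: closed_nbhd_def)
  moreover have "{p0, p2, b} \<subseteq> closed_nbhd R V p1"
    using sy assms(4,6,8,10,11,13) by (simp add: closed_nbhd_def)
  moreover have "card {p0, p2, b} = 3" using assms(6,8,9) by auto
  moreover have "p1 \<in> V" "a \<noteq> p1" using assms(7) by auto
  ultimately show False using bc_no_three_common[OF assms(1,2,3)] by blast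
qed

text \<open>The properties of the vertex set of a member of a \<open>P\<^sub>k\<close>-substructure-cut that the lower bound uses:
  \<open>f\<close> gives the positions on \<open>P\<^sub>k\<close>.\<close>

definition path_positions :: "'a rel \<Rightarrow> 'a set \<Rightarrow> nat \<Rightarrow> 'a set \<Rightarrow> bool" where
  "path_positions R V k P \<longleftrightarrow> P \<subseteq> V \<and> (\<exists>f. inj_on f P \<and> f ` P \<subseteq> {..<k} \<and>
     (\<forall>u\<in>P. \<forall>v\<in>P. f v = Suc (f u) \<longrightarrow> (u, v) \<in> R))"

lemma path_positionsE:
  assumes "path_positions R V k P"
  obtains f where "inj_on f P" "f ` P \<subseteq> {..<k}"
    "\<And>u v. u \<in> P \<Longrightarrow> v \<in> P \<Longrightarrow> f v = Suc (f u) \<Longrightarrow> (u, v) \<in> R"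
proof -
  have "\<exists>f. inj_on f P \<and> f ` P \<subseteq> {..<k} \<and> (\<forall>u\<in>P. \<forall>v\<in>P. f v = Suc (f u) \<longrightarrow> (u, v) \<in> R)"
    using assms unfolding path_positions_def by (rule conjunct2)
  then obtain f where f: "inj_on f P \<and> f ` P \<subseteq> {..<k} \<and> (\<forall>u\<in>P. \<forall>v\<in>P. f v = Suc (f u) \<longrightarrow> (u, v) \<in> R)"
    by (rule exE)
  show thesis by (rule that[of f]) (use f in simp_all)
qed

lemma path_positions_card_independent:
  assumes "path_positions R V k P" "sym R" "I \<subseteq> P" "\<And>u v. u \<in> I \<Longrightarrow> v \<in> I \<Longrightarrow> (u, v) \<notin> R"
  shows "card I \<le> (k + 1) div 2"
proof -
  obtain f where "inj_on f P" "f ` P \<subseteq> {..<k}" "\<And>u v. u \<in> P \<Longrightarrow> v \<in> P \<Longrightarrow> f v = Suc (f u) \<Longrightarrow> (u, v) \<in> R"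
    using path_positionsE[OF assms(1)] by metis
  from card_independent_le[OF this(1,2) assms(2) this(3) assms(3,4)] show ?thesis .
qed

lemma path_positions_card:
  assumes "path_positions R V k P"
  shows "card P \<le> k"
proof -
  obtain f where "inj_on f P" "f ` P \<subseteq> {..<k}"
    using path_positionsE[OF assms] by metis
  from card_inj_on_le[OF this] show ?thesis by simp
qed

text \<open>With \<open>k\<close> vertices every position is occupied, in particular 0, 1 and
  2.\<close>

lemma path_positions_full:
  assumes "path_positions R V k P" "card P = k" "3 \<le> k"
  obtains p0 p1 p2 where "p0 \<in> P" "p1 \<in> P" "p2 \<in> P" "(p0, p1) \<in> R" "(p1, p2) \<in> R" "p0 \<noteq> p2"
proof -
  obtain f where f: "inj_on f P" "f ` P \<subseteq> {..<k}"
    "\<And>u v. u \<in> P \<Longrightarrow> v \<in> P \<Longrightarrow> f v = Suc (f u) \<Longrightarrow> (u, v) \<in> R"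
    using path_positionsE[OF assms(1)] by metis
  have "f ` P = {..<k}" using f(2) card_image[OF f(1)] assms(2) by (intro card_subset_eq) auto
  then have "0 \<in> f ` P" "1 \<in> f ` P" "2 \<in> f ` P" using assms(3) by auto
  then obtain p0 p1 p2 where "p0 \<in> P" "p1 \<in> P" "p2 \<in> P" "f p0 = 0" "f p1 = 1" "f p2 = 2"
    by (metis imageE)
  moreover then have "p0 \<noteq> p2" by auto
  ultimately show thesis using that[of p0 p1 p2] f(3) by simp
qed

text \<open>The \<open>n\<close> neighbours of \<open>a\<close> are independent, so each path covers
  at most half of its positions, rounded up, among them.\<close>

lemma bc_isolated_bound:
  assumes "sym R" "bijective_connection R n V" "finite \<P>" "\<And>P. P \<in> \<P> \<Longrightarrow> path_positions R V k P"
    "a \<in> V" "closed_nbhd R V a - {a} \<subseteq> \<Union>\<P>"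
  shows "n \<le> card \<P> * ((k + 1) div 2)"
proof -
  let ?N = "closed_nbhd R V a - {a}"
  have "?N = (\<Union>P\<in>\<P>. ?N \<inter> P)" using assms(6) by blast
  moreover have "card (\<Union>P\<in>\<P>. ?N \<inter> P) \<le> card \<P> * ((k + 1) div 2)"
  proof (rule card_Union_le_times[OF assms(3)])
    fix P
    assume "P \<in> \<P>"
    show "card (?N \<inter> P) \<le> (k + 1) div 2"
    proof (rule path_positions_card_independent[OF assms(4)[OF \<open>P \<in> \<P>\<close>] assms(1)])
      fix u v
      assume "u \<in> ?N \<inter> P" "v \<in> ?N \<inter> P"
      then have "u \<in> V" "v \<in> V" "(a, u) \<in> R" "(a, v) \<in> R" by (auto simp: closed_nbhd_def)
      then show "(u, v) \<notin> R" using bc_triangle_free[OF assms(1,2,5)] by blast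
    qed simp
  qed
  moreover have "a \<in> closed_nbhd R V a" "finite (closed_nbhd R V a)"
    using bc_finite[OF assms(2)] by (auto simp: closed_nbhd_def)
  then have "card ?N = n" using bc_card_closed_nbhd[OF assms(2,5)] by simp
  ultimately show ?thesis by metis
qed

text \<open>The edge has at least 2n - 2 further neighbours and the paths have at most that many
  vertices in all. So they consist of these neighbours only, and three consecutive vertices of one
  path contradict \<open>bc_no_path_around_edge\<close>.\<close>

lemma bc_edge_bound:
  assumes "sym R" "bijective_connection R n V" "finite \<P>" "\<And>P. P \<in> \<P> \<Longrightarrow> path_positions R V k P"
    "3 \<le> k" "2 \<le> n" "card \<P> * k \<le> 2 * n - 2" "a \<in> V - \<Union>\<P>" "b \<in> V - \<Union>\<P>" "(a, b) \<in> R"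
    "closed_nbhd R V a \<subseteq> {a, b} \<union> \<Union>\<P>" "closed_nbhd R V b \<subseteq> {a, b} \<union> \<Union>\<P>"
  shows False
proof -
  let ?N = "closed_nbhd R V"
  have a: "a \<in> V" "b \<in> V" using assms by auto
  have ba: "(b, a) \<in> R" using assms(1,10) by (rule symD)
  have ab: "a \<noteq> b" using bc_irrefl[OF assms(2)] assms(10) a by blast
  have fin: "finite (?N x)" for x using bc_finite[OF assms(2)] by (simp add: closed_nbhd_def)
  have sub: "\<Union>\<P> \<subseteq> V" using assms(4) unfolding path_positions_def by blast
  then have finU: "finite (\<Union>\<P>)" using bc_finite[OF assms(2)] finite_subset by blast
  have "card (?N a \<union> ?N b) + card (?N a \<inter> ?N b) = 2 * Suc n"
    using card_Un_Int[OF fin fin, of a b] bc_card_closed_nbhd[OF assms(2)] a by simp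
  moreover have "card (?N a \<inter> ?N b) \<le> 2" using bc_card_closed_nbhd_inter[OF assms(1,2) a ab] .
  ultimately have "2 * n \<le> card (?N a \<union> ?N b)" by simp
  moreover have "card (?N a \<union> ?N b - {a, b}) = card (?N a \<union> ?N b) - card {a, b}"
    using fin by (intro card_Diff_subset) (auto simp: closed_nbhd_def)
  moreover have "card {a, b} = 2" using ab by simp
  ultimately have ge: "2 * n - 2 \<le> card (?N a \<union> ?N b - {a, b})" by simp
  have Nsub: "?N a \<union> ?N b - {a, b} \<subseteq> \<Union>\<P>" using assms(11,12) by blast
  have "card (\<Union>\<P>) \<le> card \<P> * k"
    using card_Union_le_times[OF assms(3), of "\<lambda>P. P" k] path_positions_card[OF assms(4)] by simp
  then have "card (\<Union>\<P>) \<le> card (?N a \<union> ?N b - {a, b})" using ge assms(7) by linarith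
  then have eq: "?N a \<union> ?N b - {a, b} = \<Union>\<P>" using Nsub finU by (metis card_seteq)
  have "\<P> \<noteq> {}"
  proof
    assume "\<P> = {}"
    then have "2 * n - 2 \<le> 0" using ge eq by simp
    then show False using assms(6) by simp
  qed
  then obtain P where P: "P \<in> \<P>" by blast
  \<comment> \<open>The other paths contribute at most \<open>k\<close> each, so a shorter
    \<open>P\<close> would leave the union too small.\<close>
  have "k \<le> card P"
  proof -
    have "\<Union>\<P> = P \<union> \<Union>(\<P> - {P})" using P by blast
    then have "card (\<Union>\<P>) \<le> card P + card (\<Union>(\<P> - {P}))" by (metis card_Un_le)
    moreover have "card (\<Union>(\<P> - {P})) \<le> card (\<P> - {P}) * k"
      using card_Union_le_times[of "\<P> - {P}" "\<lambda>P. P" k] path_positions_card[OF assms(4)] assms(3) by simp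
    moreover have "card \<P> = Suc (card (\<P> - {P}))" using P assms(3) by (metis card.remove)
    ultimately show ?thesis using ge eq assms(7) by simp
  qed
  then have "card P = k" using path_positions_card[OF assms(4)[OF P]] by simp
  from path_positions_full[OF assms(4)[OF P] this assms(5)]
  obtain p0 p1 p2 where p: "p0 \<in> P" "p1 \<in> P" "p2 \<in> P" "(p0, p1) \<in> R" "(p1, p2) \<in> R" "p0 \<noteq> p2" .
  have pV: "p \<in> V - {a, b} \<and> p \<in> V - {b, a} \<and> ((a, p) \<in> R \<or> (b, p) \<in> R)" if "p \<in> P" for p
  proof -
    have "p \<in> \<Union>\<P>" using that P by blast
    then have "p \<in> V" "p \<in> ?N a \<union> ?N b - {a, b}" using sub eq by auto
    then show ?thesis by (auto simp: closed_nbhd_def)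
  qed
  show False
  proof (cases "(b, p1) \<in> R")
    case True
    show ?thesis
      by (rule bc_no_path_around_edge[OF assms(1,2) a assms(10), of p0 p1 p2]) (use pV p True in blast)+
  next
    case False
    \<comment> \<open>The same argument with \<open>a\<close> and \<open>b\<close>
      exchanged.\<close>
    then have "(a, p1) \<in> R" using pV p(2) by blast
    then show ?thesis
      by (intro bc_no_path_around_edge[OF assms(1,2) a(2,1) ba, of p0 p1 p2]) (use pV p in blast)+
  qed
qed

lemma bc_path_cut_lower_bound:
  assumes "sym R" "bijective_connection R n V" "finite \<P>" "\<And>P. P \<in> \<P> \<Longrightarrow> path_positions R V k P"
    "3 \<le> k" "k \<le> n" "separation R V (\<Union>\<P>) A B" "A \<noteq> {}" "B \<noteq> {}"
  shows "n \<le> card \<P> * ((k + 1) div 2)"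
proof (rule ccontr)
  let ?h = "(k + 1) div 2" and ?t = "card \<P>" and ?F = "\<Union>\<P>"
  assume "\<not> n \<le> ?t * ?h"
  then have th: "?t * ?h + 1 \<le> n" by simp
  have F: "card ?F \<le> ?t * k"
    using card_Union_le_times[OF assms(3), of "\<lambda>P. P" k] path_positions_card[OF assms(4)] by simp
  have fin: "finite A" "finite B"
    using assms(7) bc_finite[OF assms(2)] unfolding separation_def by auto
  \<comment> \<open>A vertex with no neighbour on its own side has all its neighbours
    deleted.\<close>
  have not1: False if "separation R V ?F X Y" "a \<in> X" "\<And>x. x \<in> X \<Longrightarrow> (a, x) \<in> R \<Longrightarrow> x = a" for X Y a
  proof -
    have "a \<in> V" using that(1,2) unfolding separation_def by blast
    moreover have "closed_nbhd R V a - {a} \<subseteq> ?F"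
      using separation_nbhd[OF that(1,2)] that(3) unfolding closed_nbhd_def by blast
    ultimately show False using bc_isolated_bound[OF assms(1-4)] th by fastforce
  qed
  \<comment> \<open>A side of at most two vertices contains such a vertex or is an edge.\<close>
  have pair: False if X: "separation R V ?F X Y" "X \<noteq> {}" "finite X" "card X \<le> 2" "?t * k \<le> 2 * n - 2" for X Y
  proof -
    obtain a where a: "a \<in> X" using X(2) by blast
    show False
    proof (cases "\<exists>b. b \<in> X \<and> (a, b) \<in> R \<and> b \<noteq> a")
      case True
      then obtain b where b: "b \<in> X" "(a, b) \<in> R" "b \<noteq> a" by blast
      then have "card {a, b} = 2" by simp
      then have "X = {a, b}" using card_seteq[OF X(3), of "{a, b}"] a b X(4) by simp
      moreover have "X \<subseteq> V - ?F" using X(1) unfolding separation_def by blast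
      ultimately show False
        using bc_edge_bound[OF assms(1-5) _ X(5), of a b] separation_nbhd[OF X(1)] b assms(5,6) by simp
    next
      case False
      then show False using not1[OF X(1) a] by blast
    qed
  qed
  have small: "?t * k \<le> 2 * n - 2"
  proof -
    have "?t * k \<le> ?t * (2 * ?h)" by (intro mult_le_mono2) linarith
    also have "\<dots> = 2 * (?t * ?h)" by (rule mult.left_commute)
    finally show ?thesis using th by linarith
  qed
  have or: "card A \<le> 2 \<or> card B \<le> 2"
  proof (cases "card ?F + 3 \<le> 2 * n")
    case True
    then show ?thesis using bc_separation_singleton[OF assms(1,2,7)] by linarith
  next
    \<comment> \<open>Here the paths would have to delete exactly 2n - 2 vertices. It remains to see
      that then \<open>n\<close> is at least 5, as \<open>bc_separation_pair\<close>
      requires.\<close>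
    case False
    then have eq: "?t * k = 2 * n - 2" using F small by linarith
    have t2: "2 \<le> ?t"
    proof (rule ccontr)
      assume "\<not> 2 \<le> ?t"
      then have "?t * k \<le> k" by (cases ?t) auto
      then show False using eq assms(5,6) by linarith
    qed
    \<comment> \<open>For odd \<open>k\<close>, \<open>2 * ?h = k + 1\<close>, so
      \<open>2 * (?t * ?h)\<close> would be 2n - 2 + \<open>?t\<close>, at least 2n.\<close>
    have "even k"
    proof (rule ccontr)
      assume "odd k"
      then have "2 * ?h = k + 1" by simp
      then have "2 * (?t * ?h) = ?t * k + ?t" by (metis mult.left_commute mult_Suc_right add.commute Suc_eq_plus1)
      then show False using eq th t2 by linarith
    qed
    then have "4 \<le> k" using assms(5) by (cases "k = 3") auto
    then have "2 * 4 \<le> ?t * k" using t2 by (intro mult_le_mono)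
    then have n5: "5 \<le> n" using eq by linarith
    then have n: "n = Suc (n - 1)" by simp
    have "card ?F \<le> 2 * (n - 1)" using F small by simp
    moreover have "bijective_connection R (Suc (n - 1)) V" using assms(2) n by simp
    moreover have "4 \<le> n - 1" using n5 by simp
    ultimately show ?thesis using bc_separation_pair[OF assms(1) _ assms(7)] by blast
  qed
  from or show False
  proof
    assume "card A \<le> 2"
    with pair[OF assms(7,8) fin(1) _ small] show False .
  next
    assume "card B \<le> 2"
    with pair[OF separation_sym[OF assms(1,7)] assms(9) fin(2) _ small] show False .
  qed
qed

section \<open>Disconnected subgraphs, isomorphisms and paths\<close>

text \<open>By symmetry, reachability may be taken along the arcs of \<open>G\<close> inside
  \<open>U\<close>. For a pair not joined by a walk, \<open>A\<close> is the set reachable from its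
  first vertex.\<close>

lemma disconnected_induce_iff:
  assumes "sym (parcs G)"
  shows "disconnected (with_proj G \<restriction> U) \<longleftrightarrow>
    (\<exists>A B. A \<noteq> {} \<and> B \<noteq> {} \<and> A \<inter> B = {} \<and> A \<union> B = U \<and> (\<forall>a\<in>A. \<forall>b\<in>B. (a, b) \<notin> parcs G))"
proof -
  let ?r = "parcs G \<inter> U \<times> U"
  have "parcs (mk_symmetric (with_proj G \<restriction> U)) = ?r"
    using assms by (auto simp: parcs_mk_symmetric induce_subgraph_def dest: symD)
  then have con: "Digraph_Component.connected (with_proj G \<restriction> U) \<longleftrightarrow> U \<noteq> {} \<and> (\<forall>u\<in>U. \<forall>v\<in>U. (u, v) \<in> rtrancl_on U ?r)"
    unfolding connected_def strongly_connected_def reachable_def by simp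
  show ?thesis
  proof
    assume "disconnected (with_proj G \<restriction> U)"
    then obtain u v where uv: "u \<in> U" "v \<in> U" "(u, v) \<notin> rtrancl_on U ?r"
      unfolding disconnected_def con by auto
    let ?A = "{w. (u, w) \<in> rtrancl_on U ?r}"
    have "?A \<subseteq> U" by (auto dest: in_rtrancl_on_in_F)
    moreover have "\<forall>a\<in>?A. \<forall>b\<in>U - ?A. (a, b) \<notin> parcs G"
      by (auto intro: rtrancl_on_into_rtrancl_on dest: in_rtrancl_on_in_F)
    moreover have "u \<in> ?A" "v \<in> U - ?A" using uv by auto
    ultimately show "\<exists>A B. A \<noteq> {} \<and> B \<noteq> {} \<and> A \<inter> B = {} \<and> A \<union> B = U \<and> (\<forall>a\<in>A. \<forall>b\<in>B. (a, b) \<notin> parcs G)"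
      by (intro exI[of _ ?A] exI[of _ "U - ?A"]) blast
  next
    assume "\<exists>A B. A \<noteq> {} \<and> B \<noteq> {} \<and> A \<inter> B = {} \<and> A \<union> B = U \<and> (\<forall>a\<in>A. \<forall>b\<in>B. (a, b) \<notin> parcs G)"
    then obtain A B a b where AB: "a \<in> A" "b \<in> B" "A \<inter> B = {}" "A \<union> B = U" "\<forall>a\<in>A. \<forall>b\<in>B. (a, b) \<notin> parcs G"
      by blast
    have "w \<in> A" if "(a, w) \<in> rtrancl_on U ?r" for w
      using that by (induction rule: rtrancl_on_induct) (use AB in auto)
    then have "(a, b) \<notin> rtrancl_on U ?r" using AB by blast
    then show "disconnected (with_proj G \<restriction> U)"
      unfolding disconnected_def con using AB by auto
  qed
qed

lemma isomorphicD:
  assumes "isomorphic F S"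
  obtains f where "inj_on f (pverts F)" "pverts S = f ` pverts F"
    "\<And>u v. u \<in> pverts F \<Longrightarrow> v \<in> pverts F \<Longrightarrow> (f u, f v) \<in> parcs S \<Longrightarrow> (u, v) \<in> parcs F"
proof -
  obtain h where h: "pre_digraph.digraph_isomorphism (with_proj F) h" "with_proj S = app_iso h (with_proj F)"
    using assms unfolding isomorphic_def digraph_iso_def by blast
  let ?f = "iso_verts h"
  have inj: "inj_on ?f (pverts F)" and wf: "wf_digraph (with_proj F)"
    using h(1) unfolding pre_digraph.digraph_isomorphism_def by auto
  have V: "pverts S = ?f ` pverts F" using arg_cong[OF h(2), of verts] by simp
  have arcs: "parcs S = iso_arcs h ` parcs F" using arg_cong[OF h(2), of arcs] by simp
  \<comment> \<open>Both graphs have the projections as tail and head, so the arc map is determined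
    by the vertex map.\<close>
  have "iso_tail h = fst" "iso_head h = snd"
    using arg_cong[OF h(2), of tail] arg_cong[OF h(2), of head] by simp_all
  then have ia: "iso_arcs h a = (?f (fst a), ?f (snd a))" if "a \<in> parcs F" for a
    using h(1) that unfolding pre_digraph.digraph_isomorphism_def by (simp add: prod_eq_iff)
  have "(u, v) \<in> parcs F" if uv: "u \<in> pverts F" "v \<in> pverts F" "(?f u, ?f v) \<in> parcs S" for u v
  proof -
    obtain a where a: "a \<in> parcs F" "(?f u, ?f v) = iso_arcs h a" using uv(3) arcs by blast
    then have "?f u = ?f (fst a)" "?f v = ?f (snd a)" using ia by auto
    moreover have "fst a \<in> pverts F" "snd a \<in> pverts F"
      using wf a(1) wf_digraph.tail_in_verts[OF wf] wf_digraph.head_in_verts[OF wf] by auto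
    ultimately have "a = (u, v)" using inj uv(1,2) by (simp add: inj_on_eq_iff prod_eq_iff)
    then show ?thesis using a(1) by simp
  qed
  with inj V show thesis by (rule that)
qed

lemma isomorphicI:
  assumes "inj_on f (pverts F)" "pverts S = f ` pverts F" "parcs S = map_prod f f ` parcs F"
    "parcs F \<subseteq> pverts F \<times> pverts F"
  shows "isomorphic F S"
proof -
  let ?h = "\<lparr> iso_verts = f, iso_arcs = map_prod f f, iso_head = snd, iso_tail = fst \<rparr>"
  have "wf_digraph (with_proj F)" using assms(4) by unfold_locales auto
  moreover have "inj_on (map_prod f f) (parcs F)"
    using map_prod_inj_on[OF assms(1) assms(1)] assms(4) by (rule inj_on_subset)
  ultimately have "pre_digraph.digraph_isomorphism (with_proj F) ?h"
    unfolding pre_digraph.digraph_isomorphism_def using assms(1) by auto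
  moreover have "with_proj S = app_iso ?h (with_proj F)"
    using assms(2,3) by (simp add: with_proj_def app_iso_def)
  ultimately show ?thesis unfolding isomorphic_def digraph_iso_def by blast
qed

text \<open>A walk in \<open>S\<close> changes the position by one at each step; without this arc, a
  walk starting at \<open>i\<close> never gets beyond \<open>i\<close>.\<close>

lemma connected_path_subgraph_arc:
  assumes "usubgraph S (path_graph k)" "Digraph_Component.connected (with_proj S)"
    "i \<in> pverts S" "Suc i \<in> pverts S"
  shows "(i, Suc i) \<in> parcs S"
proof (rule ccontr)
  assume no: "(i, Suc i) \<notin> parcs S"
  have s: "sym (parcs S)" using assms(1) unfolding usubgraph_def symmetric_def by simp
  have sub: "parcs S \<subseteq> parcs (path_graph k)" using assms(1) unfolding usubgraph_def subgraph_def by simp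
  have "parcs (mk_symmetric (with_proj S)) = parcs S"
    using s by (auto simp: parcs_mk_symmetric dest: symD)
  then have "(i, Suc i) \<in> rtrancl_on (pverts S) (parcs S)"
    using assms(2-4) unfolding connected_def strongly_connected_def reachable_def by simp
  then have "Suc i \<le> i"
  proof (induction rule: rtrancl_on_induct)
    case (step y z)
    have "z \<noteq> Suc y \<or> y \<noteq> i" using no step.hyps by auto
    moreover have "z = Suc y \<or> y = Suc z" using sub step.hyps(2) by (auto simp: path_graph_def)
    ultimately show ?case using step.IH by linarith
  qed simp
  then show False by simp
qed

text \<open>The positions are the images under the isomorphism; connectedness of \<open>S\<close>
  supplies the arcs between consecutive ones.\<close>

lemma path_substructure_positions:
  assumes "usubgraph F G" "usubgraph S (path_graph k)" "Digraph_Component.connected (with_proj S)"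
    "isomorphic F S"
  obtains f where "inj_on f (pverts F)" "f ` pverts F \<subseteq> {..<k}"
    "\<And>u v. u \<in> pverts F \<Longrightarrow> v \<in> pverts F \<Longrightarrow> f v = Suc (f u) \<Longrightarrow> (u, v) \<in> parcs G"
proof -
  obtain f where f: "inj_on f (pverts F)" "pverts S = f ` pverts F"
    "\<And>u v. u \<in> pverts F \<Longrightarrow> v \<in> pverts F \<Longrightarrow> (f u, f v) \<in> parcs S \<Longrightarrow> (u, v) \<in> parcs F"
    using isomorphicD[OF assms(4)] by blast
  have "pverts S \<subseteq> pverts (path_graph k)" "parcs F \<subseteq> parcs G"
    using assms(1,2) unfolding usubgraph_def subgraph_def by auto
  then have "f ` pverts F \<subseteq> {..<k}" using f(2) by (simp add: path_graph_def)
  moreover have "(u, v) \<in> parcs G" if uv: "u \<in> pverts F" "v \<in> pverts F" "f v = Suc (f u)" for u v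
  proof -
    have "f u \<in> pverts S" "Suc (f u) \<in> pverts S" using uv f(2) by (auto simp flip: uv(3))
    then have "(f u, Suc (f u)) \<in> parcs S" by (rule connected_path_subgraph_arc[OF assms(2,3)])
    then show ?thesis using f(3) uv \<open>parcs F \<subseteq> parcs G\<close> by auto
  qed
  ultimately show thesis using that f(1) by blast
qed

section \<open>The twisted hypercube\<close>

text \<open>For n \<ge> 2, log n \<le> n - 1 and the iterated logarithm is nonnegative. Consequently
  the twist adds to a coordinate only a strictly later one.\<close>

lemma kappa_less:
  assumes "1 \<le> n"
  shows "kappa n < n"
proof (cases "n = 1")
  case True
  then show ?thesis by (simp add: kappa_def)
next
  case False
  then have n: "2 \<le> n" using assms by simp
  have "n \<le> 2 ^ (n - 1)"
    using assms less_exp[of "n - 1"] by linarith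
  then have "real n \<le> 2 ^ (n - 1)" by (metis of_nat_le_iff of_nat_numeral of_nat_power)
  then have "log 2 (real n) \<le> log 2 (2 ^ (n - 1))"
    using n by (subst log_le_cancel_iff) auto
  then have "log 2 (real n) \<le> real (n - 1)" by simp
  moreover have "1 \<le> log 2 (real n)" using n by (subst one_le_log_cancel_iff) auto
  then have "0 \<le> log 2 (log 2 (real n))" by (subst zero_le_log_cancel_iff) auto
  ultimately have "log 2 (real n) - 2 * log 2 (log 2 (real n)) \<le> of_int (int (n - 1))" by simp
  then have "\<lceil>log 2 (real n) - 2 * log 2 (log 2 (real n))\<rceil> \<le> int (n - 1)"
    by (simp only: ceiling_le_iff)
  then have "max 1 \<lceil>log 2 (real n) - 2 * log 2 (log 2 (real n))\<rceil> < int n" using n by auto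
  then show ?thesis using n unfolding kappa_def by (simp add: nat_less_iff)
qed

lemma length_twist [simp]: "length (twist x) = length x"
  by (simp add: twist_def Let_def)

lemma twist_nth:
  "i < length x \<Longrightarrow> twist x ! i =
    (if i < kappa (length x) then x ! i + x ! (length x - kappa (length x) + i) else x ! i)"
  by (simp add: twist_def Let_def)

text \<open>Coordinates are recovered from the last to the first, since the one added at
  \<open>i\<close> comes later than \<open>i\<close>.\<close>

lemma twist_inj:
  assumes "length x = length y" "twist x = twist y"
  shows "x = y"
proof (rule nth_equalityI[OF assms(1)])
  fix i
  assume "i < length x"
  then show "x ! i = y ! i"
  proof (induction "length x - i" arbitrary: i rule: less_induct)
    case less
    let ?k = "kappa (length x)"
    have k: "?k < length x" using less.prems kappa_less[of "length x"] by linarith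
    have *: "twist x ! i = twist y ! i" using assms by simp
    show ?case
    proof (cases "i < ?k")
      case True
      have "x ! (length x - ?k + i) = y ! (length x - ?k + i)"
        using less.hyps[of "length x - ?k + i"] less.prems k True by simp
      moreover have "x ! i + x ! (length x - ?k + i) = y ! i + y ! (length x - ?k + i)"
        using * True less.prems assms(1) by (simp only: twist_nth if_True)
      ultimately show ?thesis by (metis add_right_cancel)
    next
      case False
      then show ?thesis using * less.prems assms(1) by (simp add: twist_nth)
    qed
  qed
qed

lemma bij_twist: "bij_betw twist {x. length x = n} {x. length x = n}"
proof -
  have "UNIV = {0, 1 :: bit}" by (auto intro: bit.exhaust)
  then have "finite (UNIV :: bit set)" by (metis finite.emptyI finite.insertI)
  then have "finite {x :: bit list. length x = n}"
    using finite_lists_length_eq[of "UNIV :: bit set" n] by simp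
  moreover have "inj_on twist {x. length x = n}" by (auto intro!: inj_onI twist_inj)
  ultimately have "twist ` {x. length x = n} = {x. length x = n}"
    by (intro endo_inj_surj) auto
  then show ?thesis using \<open>inj_on twist _\<close> unfolding bij_betw_def by blast
qed

lemma twist_zeros: "twist (replicate n 0) = replicate n 0"
proof (rule nth_equalityI)
  show "twist (replicate n 0) ! i = replicate n 0 ! i" if "i < length (twist (replicate n 0))" for i
    using that kappa_less[of n] by (simp add: twist_nth)
qed simp

text \<open>The coordinates that get added never include the first, so the leading 1 is not
  copied.\<close>

lemma twist_unit: "twist (1 # replicate n 0) = 1 # replicate n 0"
proof (rule nth_equalityI)
  fix i
  assume i: "i < length (twist (1 # replicate n 0))"
  have "kappa (Suc n) < Suc n" by (rule kappa_less) simp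
  then show "twist (1 # replicate n 0) ! i = (1 # replicate n 0) ! i"
    using i by (auto simp add: twist_nth nth_Cons')
qed simp

section \<open>Twisted hypercubes as bijective connections\<close>

abbreviation H_arcs :: "nat \<Rightarrow> bit list rel" where
  "H_arcs n \<equiv> parcs (twisted_hypercube n)"

lemma pverts_twisted_hypercube: "pverts (twisted_hypercube n) = {x. length x = n}"
proof (cases n rule: twisted_hypercube.cases)
  case 2
  have "x = 0 \<or> x = 1" for x :: bit by (cases x) auto
  then show ?thesis using 2 by (auto simp: length_Suc_conv)
qed auto

lemma H_arcs_Suc: "H_arcs (Suc n) = {(b # x, b # y) | b x y. (x, y) \<in> H_arcs n}
    \<union> {(0 # x, 1 # twist x) | x. length x = n} \<union> {(1 # twist x, 0 # x) | x. length x = n}"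
  by (cases n) (auto simp: twist_def)

lemma Cons_in_H_arcs_iff:
  "(b # x, c # y) \<in> H_arcs (Suc n) \<longleftrightarrow> b = c \<and> (x, y) \<in> H_arcs n \<or>
     b = 0 \<and> c = 1 \<and> length x = n \<and> y = twist x \<or> b = 1 \<and> c = 0 \<and> length y = n \<and> x = twist y"
  unfolding H_arcs_Suc by auto

lemma H_arcs_subset: "(x, y) \<in> H_arcs n \<Longrightarrow> length x = n \<and> length y = n"
proof (induction n arbitrary: x y)
  case (Suc n)
  from Suc.prems consider b u v where "x = b # u" "y = b # v" "(u, v) \<in> H_arcs n"
    | u where "x = 0 # u" "y = 1 # twist u" "length u = n"
    | u where "x = 1 # twist u" "y = 0 # u" "length u = n"
    unfolding H_arcs_Suc by blast
  then show ?case using Suc.IH by cases auto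
qed simp

lemma sym_H_arcs: "sym (H_arcs n)"
proof (induction n)
  case (Suc n)
  then show ?case unfolding H_arcs_Suc sym_def by blast
qed (simp add: sym_def)

lemma bc_twisted_hypercube: "bijective_connection (H_arcs n) n {x. length x = n}"
proof (induction n)
  case 0
  then show ?case by auto
next
  case (Suc n)
  let ?L = "{x :: bit list. length x = n}"
  have *: "bijective_connection (H_arcs (Suc n)) n ((#) b ` ?L)" for b
    by (rule bc_image[OF Suc]) (auto simp: Cons_in_H_arcs_iff simp del: twisted_hypercube.simps(2,3))
  have "x = 0 \<or> x = 1" for x :: bit by (cases x) auto
  then have V: "{x. length x = Suc n} = (#) 0 ` ?L \<union> (#) 1 ` ?L"
    by (auto simp: length_Suc_conv)
  have "matched (H_arcs (Suc n)) ((#) 0 ` ?L) ((#) 1 ` ?L)"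
    unfolding matched_def by (auto simp: Cons_in_H_arcs_iff simp del: twisted_hypercube.simps(2,3))
  \<comment> \<open>Existence of the partner is surjectivity of \<open>twist\<close>, uniqueness its
    injectivity.\<close>
  moreover have "matched (H_arcs (Suc n)) ((#) 1 ` ?L) ((#) 0 ` ?L)"
    unfolding matched_def
  proof
    fix z assume "z \<in> (#) 1 ` ?L"
    then obtain y where y: "z = 1 # y" "length y = n" by auto
    then have "y \<in> twist ` ?L" by (simp add: bij_betw_imp_surj_on[OF bij_twist])
    then obtain x where x: "length x = n" "twist x = y" by blast
    show "\<exists>!w. w \<in> (#) 0 ` ?L \<and> (z, w) \<in> H_arcs (Suc n)"
    proof (rule ex1I[of _ "0 # x"])
      show "0 # x \<in> (#) 0 ` ?L \<and> (z, 0 # x) \<in> H_arcs (Suc n)"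
        using x y by (simp add: Cons_in_H_arcs_iff del: twisted_hypercube.simps(2,3))
      fix w
      assume w: "w \<in> (#) 0 ` ?L \<and> (z, w) \<in> H_arcs (Suc n)"
      then obtain v where v: "w = 0 # v" "length v = n" by blast
      then have "y = twist v" using w by (simp add: y Cons_in_H_arcs_iff del: twisted_hypercube.simps(2,3))
      then have "v = x" using v x twist_inj[of v x] by metis
      then show "w = 0 # x" using v by simp
    qed
  qed
  moreover have "(#) 0 ` ?L \<inter> (#) 1 ` ?L = {}" by auto
  ultimately show ?case unfolding bijective_connection.simps(2) V using * by blast
qed

text \<open>The even entries of this path are the neighbours of the zero vertex.\<close>

fun nbr_path :: "nat \<Rightarrow> nat \<Rightarrow> bit list" where
  "nbr_path 0 j = []"
| "nbr_path (Suc n) 0 = 1 # replicate n 0"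
| "nbr_path (Suc n) (Suc 0) = 1 # nbr_path n 0"
| "nbr_path (Suc n) (Suc (Suc j)) = 0 # nbr_path n j"

lemma length_nbr_path: "length (nbr_path n j) = n"
  by (induction n j rule: nbr_path.induct) auto

lemma zeros_nbr_path_0: "(replicate (Suc n) 0, nbr_path (Suc n) 0) \<in> H_arcs (Suc n)"
  by (simp add: Cons_in_H_arcs_iff twist_zeros del: twisted_hypercube.simps(2,3))

text \<open>The path has the indices 0 to 2n - 2. Its first step is an edge of the copy with prefix
  1, its second a matching edge because \<open>twist\<close> fixes the first unit vector, and the
  rest lies in the copy with prefix 0.\<close>

lemma nbr_path_step: "Suc (Suc j) < 2 * n \<Longrightarrow> (nbr_path n j, nbr_path n (Suc j)) \<in> H_arcs n"
proof (induction n j rule: nbr_path.induct)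
  case (2 n)
  then obtain m where "n = Suc m" by (cases n) auto
  then show ?case using zeros_nbr_path_0[of m]
    by (simp only: nbr_path.simps Cons_in_H_arcs_iff) simp
next
  case (3 n)
  then obtain m where m: "n = Suc m" by (cases n) auto
  have "twist (nbr_path n 0) = nbr_path n 0" unfolding m nbr_path.simps by (rule twist_unit)
  then show ?case unfolding nbr_path.simps Cons_in_H_arcs_iff using length_nbr_path[of n 0] by simp
next
  case (4 n j)
  then show ?case unfolding nbr_path.simps Cons_in_H_arcs_iff by simp
qed simp

lemma nbr_path_neq_zeros: "Suc j < 2 * n \<Longrightarrow> nbr_path n j \<noteq> replicate n 0"
  by (induction n j rule: nbr_path.induct) auto

lemma nbr_path_inj: "Suc i < 2 * n \<Longrightarrow> Suc j < 2 * n \<Longrightarrow> nbr_path n i = nbr_path n j \<Longrightarrow> i = j"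
proof (induction n i arbitrary: j rule: nbr_path.induct)
  case (2 n)
  then show ?case using nbr_path_neq_zeros[of 0 n] by (cases "(Suc n, j)" rule: nbr_path.cases) auto
next
  case (3 n)
  then show ?case using nbr_path_neq_zeros[of 0 n] by (cases "(Suc n, j)" rule: nbr_path.cases) auto
next
  case (4 n i)
  then show ?case by (cases "(Suc n, j)" rule: nbr_path.cases) auto
qed auto

text \<open>The partner of zero is entry 0; the other neighbours come from the copy with prefix 0,
  where indices shift by two.\<close>

lemma zeros_neighbour:
  "(replicate n 0, y) \<in> H_arcs n \<Longrightarrow> \<exists>i<n. y = nbr_path n (2 * i)"
proof (induction n arbitrary: y)
  case (Suc n)
  obtain c z where y: "y = c # z" using H_arcs_subset[OF Suc.prems] by (cases y) auto
  from Suc.prems consider "c = 0" "(replicate n 0, z) \<in> H_arcs n" | "c = 1" "z = replicate n 0"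
    unfolding y replicate_Suc Cons_in_H_arcs_iff by (auto simp: twist_zeros)
  then show ?case
  proof cases
    case 1
    then obtain i where "i < n" "z = nbr_path n (2 * i)" using Suc.IH by blast
    then have "Suc i < Suc n" "y = nbr_path (Suc n) (2 * Suc i)" using 1 y by simp_all
    then show ?thesis by blast
  next
    case 2
    then have "y = nbr_path (Suc n) (2 * 0)" using y by simp
    then show ?thesis by blast
  qed
qed simp

section \<open>Structure connectivity of the twisted hypercube\<close>

lemma substructure_cut_lower_bound:
  assumes "substructure_cut (twisted_hypercube n) (path_graph k) \<F>" "3 \<le> k" "k \<le> n"
  shows "n \<le> card \<F> * ((k + 1) div 2)"
proof -
  let ?V = "{x :: bit list. length x = n}" and ?P = "pverts ` \<F>"
  have fin: "finite \<F>" using assms(1) unfolding substructure_cut_def by blast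
  have pos: "path_positions (H_arcs n) ?V k P" if P: "P \<in> ?P" for P
  proof -
    obtain F where F: "F \<in> \<F>" "P = pverts F" using P by blast
    then obtain S where S: "usubgraph F (twisted_hypercube n)" "usubgraph S (path_graph k)"
      "Digraph_Component.connected (with_proj S)" "isomorphic F S"
      using assms(1) unfolding substructure_cut_def by blast
    obtain f where f: "inj_on f (pverts F)" "f ` pverts F \<subseteq> {..<k}"
      "\<And>u v. u \<in> pverts F \<Longrightarrow> v \<in> pverts F \<Longrightarrow> f v = Suc (f u) \<Longrightarrow> (u, v) \<in> H_arcs n"
      using path_substructure_positions[OF S] by metis
    have "pverts F \<subseteq> ?V"
      using S(1) unfolding usubgraph_def subgraph_def by (simp add: pverts_twisted_hypercube)
    then show ?thesis unfolding path_positions_def F(2) using f by (intro conjI exI[of _ f]) auto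
  qed
  then have sub: "\<Union>?P \<subseteq> ?V" unfolding path_positions_def by blast
  have "disconnected (with_proj (twisted_hypercube n) \<restriction> (?V - \<Union>?P))"
    using assms(1) unfolding substructure_cut_def delete_subgraphs_def pverts_twisted_hypercube by simp
  then obtain A B where AB: "A \<noteq> {}" "B \<noteq> {}" "A \<inter> B = {}" "A \<union> B = ?V - \<Union>?P"
    "\<forall>a\<in>A. \<forall>b\<in>B. (a, b) \<notin> H_arcs n"
    unfolding disconnected_induce_iff[OF sym_H_arcs] by (elim exE conjE)
  have "separation (H_arcs n) ?V (\<Union>?P) A B"
    unfolding separation_def using AB(3-5) sub by (intro conjI) (simp_all, (blast+)?)
  then have "n \<le> card ?P * ((k + 1) div 2)"
    using bc_path_cut_lower_bound[OF sym_H_arcs bc_twisted_hypercube _ pos assms(2,3)] fin AB(1,2) by blast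
  \<comment> \<open>Different members may have the same vertex set.\<close>
  also have "\<dots> \<le> card \<F> * ((k + 1) div 2)" using card_image_le[OF fin] by (rule mult_le_mono1)
  finally show ?thesis .
qed

section \<open>Cuts by copies of the path: the upper bound\<close>

lemma sym_path_graph: "sym (parcs (path_graph k))"
  by (auto simp: path_graph_def sym_def)

lemma wf_path_graph: "wf_digraph (with_proj (path_graph k))"
  by unfold_locales (auto simp: path_graph_def)

lemma connected_path_graph:
  assumes "0 < k"
  shows "Digraph_Component.connected (with_proj (path_graph k))"
proof -
  let ?R = "rtrancl_on {..<k} (parcs (path_graph k))"
  have mk: "parcs (mk_symmetric (with_proj (path_graph k))) = parcs (path_graph k)"
    using sym_path_graph[of k] by (auto simp: parcs_mk_symmetric dest: symD)
  have "(0, i) \<in> ?R" if "i < k" for i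
    using that
  proof (induction i)
    case (Suc i)
    then have "(i, Suc i) \<in> parcs (path_graph k)" by (simp add: path_graph_def)
    with Suc show ?case by (auto intro: rtrancl_on_into_rtrancl_on)
  qed simp
  moreover from this have "(i, 0) \<in> ?R" if "i < k" for i
    using that symD[OF rtrancl_on_sym[OF sym_path_graph]] by blast
  ultimately have "(i, j) \<in> ?R" if "i < k" "j < k" for i j
    using that rtrancl_on_trans by metis
  moreover have "pverts (path_graph k) = {..<k}" by (simp add: path_graph_def)
  moreover have "{..<k} \<noteq> {}" using assms by auto
  ultimately show ?thesis
    unfolding connected_def strongly_connected_def reachable_def by (simp add: mk)
qed

lemma structure_cut_imp_substructure_cut:
  assumes "structure_cut G (path_graph k) \<F>" "0 < k"
  shows "substructure_cut G (path_graph k) \<F>"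
proof -
  have "usubgraph (path_graph k) (path_graph k)"
    using wf_path_graph sym_path_graph by (auto simp: usubgraph_def subgraph_def symmetric_def)
  then show ?thesis
    using assms(1) connected_path_graph[OF assms(2)] unfolding structure_cut_def substructure_cut_def
    by blast
qed

definition path_from :: "(nat \<Rightarrow> 'a) \<Rightarrow> nat \<Rightarrow> nat \<Rightarrow> 'a pair_pre_digraph" where
  "path_from p a k = \<lparr> pverts = (\<lambda>i. p (a + i)) ` {..<k},
     parcs = map_prod (\<lambda>i. p (a + i)) (\<lambda>i. p (a + i)) ` parcs (path_graph k) \<rparr>"

lemma isomorphic_path_from:
  assumes "inj_on p {a..<a + k}"
  shows "isomorphic (path_from p a k) (path_graph k)"
proof -
  let ?g = "\<lambda>i. p (a + i)"
  let ?f = "the_inv_into {..<k} ?g"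
  have inj: "inj_on ?g {..<k}"
  proof (rule inj_onI)
    fix x y
    assume "x \<in> {..<k}" "y \<in> {..<k}" "p (a + x) = p (a + y)"
    then show "x = y" using inj_onD[OF assms, of "a + x" "a + y"] by simp
  qed
  have sub: "parcs (path_graph k) \<subseteq> {..<k} \<times> {..<k}" by (auto simp: path_graph_def)
  show ?thesis
  proof (rule isomorphicI[of ?f])
    show "inj_on ?f (pverts (path_from p a k))"
      using inj_on_the_inv_into[OF inj] by (simp add: path_from_def)
    show "pverts (path_graph k) = ?f ` pverts (path_from p a k)"
      using the_inv_into_onto[OF inj] by (simp add: path_from_def path_graph_def)
    have "map_prod ?f ?f (map_prod ?g ?g e) = e" if "e \<in> parcs (path_graph k)" for e
      using sub that the_inv_into_f_f[OF inj] by auto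
    then have "map_prod ?f ?f ` map_prod ?g ?g ` parcs (path_graph k) = parcs (path_graph k)"
      unfolding image_image by simp
    then show "parcs (path_graph k) = map_prod ?f ?f ` parcs (path_from p a k)"
      by (simp add: path_from_def)
    show "parcs (path_from p a k) \<subseteq> pverts (path_from p a k) \<times> pverts (path_from p a k)"
      using sub by (auto simp: path_from_def)
  qed
qed

lemma usubgraph_path_from:
  assumes "wf_digraph (with_proj G)" "sym (parcs G)" "0 < k"
    "\<And>i. i < k \<Longrightarrow> p (a + i) \<in> pverts G" "\<And>i. Suc i < k \<Longrightarrow> (p (a + i), p (a + Suc i)) \<in> parcs G"
  shows "usubgraph (path_from p a k) G"
proof -
  have "(p (a + Suc i), p (a + i)) \<in> parcs G" if "Suc i < k" for i
    using assms(5)[OF that] assms(2) by (auto dest: symD)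
  then have "parcs (path_from p a k) \<subseteq> parcs G"
    using assms(5) by (auto simp: path_from_def path_graph_def)
  moreover have "parcs (path_graph k) \<subseteq> {..<k} \<times> {..<k}" by (auto simp: path_graph_def)
  then have "wf_digraph (with_proj (path_from p a k))"
    by unfold_locales (auto simp: path_from_def)
  moreover have "sym (parcs (path_from p a k))"
  proof (rule symI)
    fix x y
    assume "(x, y) \<in> parcs (path_from p a k)"
    then obtain i j where "(i, j) \<in> parcs (path_graph k)" "x = p (a + i)" "y = p (a + j)"
      by (auto simp: path_from_def)
    moreover from this have "(j, i) \<in> parcs (path_graph k)" using sym_path_graph by (auto dest: symD)
    ultimately show "(y, x) \<in> parcs (path_from p a k)" by (force simp: path_from_def)
  qed
  moreover have "pverts (path_from p a k) \<subseteq> pverts G" using assms(4) by (auto simp: path_from_def)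
  ultimately show ?thesis
    using assms(1) by (auto simp: usubgraph_def subgraph_def symmetric_def)
qed

lemma wf_twisted_hypercube: "wf_digraph (with_proj (twisted_hypercube n))"
  by unfold_locales (auto simp: pverts_twisted_hypercube dest: H_arcs_subset)

lemma structure_cut_exists:
  assumes "3 \<le> k" "k \<le> n" "n \<le> N * ((k + 1) div 2)"
  obtains \<F> where "structure_cut (twisted_hypercube n) (path_graph k) \<F>" "card \<F> \<le> N"
proof -
  let ?h = "(k + 1) div 2"
  \<comment> \<open>Path \<open>j\<close> is meant for neighbours \<open>j * ?h\<close> to
    \<open>j * ?h + ?h - 1\<close>, which occupy even indices. The minimum moves late paths back so
    that all \<open>k\<close> vertices have indices up to 2n - 2.\<close>
  define s where "s j = min (2 * (j * ?h)) (2 * n - 1 - k)" for j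
  define \<F> where "\<F> = (\<lambda>j. path_from (nbr_path n) (s j) k) ` {..<N}"
  have s: "s j + k \<le> 2 * n - 1" for j using assms(1,2) by (simp add: s_def)
  have verts: "pverts (path_from (nbr_path n) (s j) k) = nbr_path n ` {s j..<s j + k}" for j
  proof -
    have "{s j..<s j + k} = (+) (s j) ` {..<k}"
      by (simp add: lessThan_atLeast0 add.commute)
    then show ?thesis by (simp add: path_from_def image_image)
  qed
  have inj: "inj_on (nbr_path n) {..<2 * n - 1}"
  proof (rule inj_onI)
    fix x y
    assume "x \<in> {..<2 * n - 1}" "y \<in> {..<2 * n - 1}" "nbr_path n x = nbr_path n y"
    then show "x = y" using nbr_path_inj[of x n y] by simp
  qed
  have mem: "usubgraph F (twisted_hypercube n) \<and> isomorphic F (path_graph k)" if F_in: "F \<in> \<F>" for F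
  proof -
    obtain j where F: "F = path_from (nbr_path n) (s j) k" using F_in unfolding \<F>_def by blast
    have "inj_on (nbr_path n) {s j..<s j + k}" by (rule inj_on_subset[OF inj]) (use s[of j] in auto)
    then have "isomorphic F (path_graph k)" unfolding F by (rule isomorphic_path_from)
    moreover have "usubgraph F (twisted_hypercube n)"
      unfolding F
    proof (rule usubgraph_path_from[OF wf_twisted_hypercube sym_H_arcs])
      show "(nbr_path n (s j + i), nbr_path n (s j + Suc i)) \<in> H_arcs n" if "Suc i < k" for i
        using nbr_path_step[of "s j + i" n] s[of j] that by simp
    qed (use assms(1) in \<open>simp_all add: pverts_twisted_hypercube length_nbr_path\<close>)
    ultimately show ?thesis by blast
  qed
  let ?V = "{x :: bit list. length x = n}" and ?X = "\<Union>F\<in>\<F>. pverts F" and ?z = "replicate n (0 :: bit)"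
  have X: "?X \<subseteq> nbr_path n ` {..<2 * n - 1}"
  proof
    fix x
    assume "x \<in> ?X"
    then obtain j where "x \<in> nbr_path n ` {s j..<s j + k}" unfolding \<F>_def by (auto simp: verts)
    moreover have "{s j..<s j + k} \<subseteq> {..<2 * n - 1}" using s[of j] by auto
    ultimately show "x \<in> nbr_path n ` {..<2 * n - 1}" by blast
  qed
  have even: "nbr_path n (2 * i) \<in> ?X" if i: "i < n" for i
  proof -
    \<comment> \<open>Index 2i exceeds the intended start by at most \<open>2 * ?h - 2\<close>,
      which is less than \<open>k\<close>. If the start was moved back, the path runs up to index 2n
      - 2, which is at least 2i.\<close>
    let ?j = "i div ?h"
    have "i < N * ?h" using i assms(3) by linarith
    then have "?j < N" by (rule less_mult_imp_div_less)
    have "?j * ?h \<le> i" by (rule div_times_less_eq_dividend)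
    moreover have "0 < ?h" using assms(1) by linarith
    then have "i < ?j * ?h + ?h" by (metis add.commute dividend_less_div_times)
    moreover have "2 * ?h \<le> k + 1" by simp
    ultimately have "2 * (?j * ?h) \<le> 2 * i" "2 * i < 2 * (?j * ?h) + k" by linarith+
    moreover have "2 * i < 2 * n - 1 - k + k" using i assms(1,2) by linarith
    ultimately have "2 * i \<in> {s ?j..<s ?j + k}"
      unfolding s_def atLeastLessThan_iff by (intro conjI; linarith)
    then show ?thesis using \<open>?j < N\<close> verts[of ?j] unfolding \<F>_def by auto
  qed
  have z: "?z \<in> ?V - ?X"
  proof -
    have "?z \<notin> nbr_path n ` {..<2 * n - 1}" using nbr_path_neq_zeros[of _ n] by force
    then show ?thesis using X by auto
  qed
  have "disconnected (with_proj (twisted_hypercube n) \<restriction> (?V - ?X))"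
    unfolding disconnected_induce_iff[OF sym_H_arcs]
  proof (intro exI conjI ballI)
    show "{?z} \<noteq> {}" "{?z} \<inter> (?V - ?X - {?z}) = {}" by auto
    show "{?z} \<union> (?V - ?X - {?z}) = ?V - ?X" using z by blast
    show "(a, b) \<notin> H_arcs n" if "a \<in> {?z}" "b \<in> ?V - ?X - {?z}" for a b
    proof
      assume "(a, b) \<in> H_arcs n"
      then obtain i where "i < n" "b = nbr_path n (2 * i)" using \<open>a \<in> {?z}\<close> zeros_neighbour[of n b] by auto
      then have "b \<in> ?X" using even by simp
      then show False using \<open>b \<in> ?V - ?X - {?z}\<close> by blast
    qed
    \<comment> \<open>At most 2n - 1 vertices are deleted; together with zero these are fewer than
      \<open>2 ^ n\<close>.\<close>
    show "?V - ?X - {?z} \<noteq> {}"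
    proof
      assume "?V - ?X - {?z} = {}"
      then have "?V \<subseteq> insert ?z (nbr_path n ` {..<2 * n - 1})" using X by blast
      then have "card ?V \<le> card (insert ?z (nbr_path n ` {..<2 * n - 1}))" by (intro card_mono) auto
      also have "\<dots> \<le> Suc (card (nbr_path n ` {..<2 * n - 1}))" by (simp add: card_insert_if)
      also have "\<dots> \<le> 2 * n" using card_image_le[of "{..<2 * n - 1}" "nbr_path n"] assms by simp
      finally have "2 ^ n \<le> 2 * n" using bc_card[OF bc_twisted_hypercube] by metis
      moreover have "3 \<le> n" using assms by simp
      then have "2 * n < 2 ^ n" by (induction n rule: dec_induct) auto
      ultimately show False by simp
    qed
  qed
  then have "structure_cut (twisted_hypercube n) (path_graph k) \<F>"
    unfolding structure_cut_def delete_subgraphs_def pverts_twisted_hypercube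
    using mem by (simp add: \<F>_def)
  moreover have "card \<F> \<le> N" unfolding \<F>_def using card_image_le[of "{..<N}"] by simp
  ultimately show thesis by (rule that)
qed

text \<open>The condition on \<open>N\<close> makes it the least \<open>t\<close> with
  \<open>n \<le> t * ((k + 1) div 2)\<close>, which treats both parities at once. The lower bound
  comes from substructure cuts, the upper bound from a structure cut, and each serves both
  connectivities.\<close>

lemma path_connectivity_twisted_hypercube:
  assumes "3 \<le> k" "k \<le> n" "\<And>t. N \<le> t \<longleftrightarrow> n \<le> t * ((k + 1) div 2)"
  shows "structure_connectivity (twisted_hypercube n) (path_graph k) = enat N"
    and "substructure_connectivity (twisted_hypercube n) (path_graph k) = enat N"
proof -
  let ?G = "twisted_hypercube n" and ?T = "path_graph k"
  have k: "0 < k" using assms(1) by simp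
  obtain \<F> where F: "structure_cut ?G ?T \<F>" "card \<F> \<le> N"
    using structure_cut_exists[OF assms(1,2)] assms(3)[of N] by blast
  have lower: "enat N \<le> enat (card \<F>)" if "substructure_cut ?G ?T \<F>" for \<F>
    using substructure_cut_lower_bound[OF that assms(1,2)] assms(3) by simp
  show "structure_connectivity ?G ?T = enat N"
    unfolding structure_connectivity_def
  proof (rule antisym)
    show "(INF \<F>\<in>{\<F>. structure_cut ?G ?T \<F>}. enat (card \<F>)) \<le> enat N"
      using F by (intro INF_lower2[of \<F>]) auto
    show "enat N \<le> (INF \<F>\<in>{\<F>. structure_cut ?G ?T \<F>}. enat (card \<F>))"
      using lower structure_cut_imp_substructure_cut[OF _ k] by (intro INF_greatest) blast
  qed
  show "substructure_connectivity ?G ?T = enat N"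
    unfolding substructure_connectivity_def
  proof (rule antisym)
    show "(INF \<F>\<in>{\<F>. substructure_cut ?G ?T \<F>}. enat (card \<F>)) \<le> enat N"
      using F structure_cut_imp_substructure_cut[OF _ k] by (intro INF_lower2[of \<F>]) auto
    show "enat N \<le> (INF \<F>\<in>{\<F>. substructure_cut ?G ?T \<F>}. enat (card \<F>))"
      using lower by (intro INF_greatest) blast
  qed
qed

lemma nat_ceiling_divide_le_iff:
  assumes "0 < c"
  shows "nat \<lceil>real a / real c\<rceil> \<le> t \<longleftrightarrow> a \<le> t * c"
proof -
  have "nat \<lceil>real a / real c\<rceil> \<le> t \<longleftrightarrow> real a / real c \<le> real t" by (simp add: nat_le_iff ceiling_le_iff)
  also have "\<dots> \<longleftrightarrow> real a \<le> real (t * c)" using assms by (simp add: pos_divide_le_eq)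
  finally show ?thesis by (simp only: of_nat_le_iff)
qed

theorem theorem4p9:
  fixes k n :: nat
  assumes "3 \<le> k" and "k \<le> n"
  shows "(odd k \<longrightarrow>
            structure_connectivity (twisted_hypercube n) (path_graph k)
              = enat (nat \<lceil>real (2 * n) / real (k + 1)\<rceil>) \<and>
            substructure_connectivity (twisted_hypercube n) (path_graph k)
              = enat (nat \<lceil>real (2 * n) / real (k + 1)\<rceil>)) \<and>
         (even k \<longrightarrow>
            structure_connectivity (twisted_hypercube n) (path_graph k)
              = enat (nat \<lceil>real (2 * n) / real k\<rceil>) \<and>
            substructure_connectivity (twisted_hypercube n) (path_graph k)
              = enat (nat \<lceil>real (2 * n) / real k\<rceil>))"
proof -
  \<comment> \<open>Twice \<open>(k + 1) div 2\<close> is the denominator in either case: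
    \<open>k + 1\<close> for odd \<open>k\<close>, \<open>k\<close> for even
    \<open>k\<close>.\<close>
  have "nat \<lceil>real (2 * n) / real c\<rceil> \<le> t \<longleftrightarrow> n \<le> t * ((k + 1) div 2)" if "c = 2 * ((k + 1) div 2)" for c t
  proof -
    have "0 < c" using that assms(1) by linarith
    then have "nat \<lceil>real (2 * n) / real c\<rceil> \<le> t \<longleftrightarrow> 2 * n \<le> t * c" by (rule nat_ceiling_divide_le_iff)
    also have "\<dots> \<longleftrightarrow> n \<le> t * ((k + 1) div 2)" unfolding that by simp
    finally show ?thesis .
  qed
  moreover have "k + 1 = 2 * ((k + 1) div 2)" if "odd k" using that by simp
  moreover have "k = 2 * ((k + 1) div 2)" if "even k" using that by simp
  ultimately show ?thesis
    by (intro conjI impI path_connectivity_twisted_hypercube[OF assms]) blast+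
qed

end
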